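(* For each agent $i$ there exists an optimal mechanism $x_i$ for agent $i$ which is a monotone threshold mechanism with partition $\mathcal S_i$ such that, for some countable subcollection $\mathcal T_i\subset\mathcal S_i$ of intervals: (1) for every interval $S\in\mathcal S_i\setminus\mathcal T_i$ and every $s_i\in S$, $x_i(s_i,s_{-i})=\mathbb I\{\mathrm{LR}(s_i,s_{-i})\ge1\}$ for all $s_{-i}$; (2) whenever $S,T\in\mathcal T_i$ are adjacent intervals, on one of the two intervals the mechanism has the form $x_i(s_i,s_{-i})=\kappa\,\mathbb I\{\mathrm{LR}(s_{-i})\ge\tau\}$ with $\kappa\in\{0,1\}$ (i.e., it is deterministic there).
   Context: Setup. A state $\omega\in\{-1,+1\}$ is drawn with $\mathbb P[\omega=+1]=\mathbb P[\omega=-1]=1/2$. There are $n\ge 2$ agents. Conditional on $\omega$, signals $s_1,\dots,s_n$ are i.i.d. with distribution $\mathbb F_\omega$ on $[0,1]$, normalized so that $s_i=\mathbb P[\omega=+1\mid s_i]$. $\mathbb F_{-1},\mathbb F_{+1}$ are mutually absolutely continuous with densities; $\mathbb F=(\mathbb F_{-1}+\mathbb F_{+1})/2$ has density $f$ supported on a non-singleton interval with endpoints $\underline s<\overline s$ in $[0,1]$, $f$ differentiable on its support with continuous derivative and $|f'/f|$ bounded. $\mathrm{LR}(E)=\mathbb P[E\mid\omega=+1]/\mathbb P[E\mid\omega=-1]$; $\mathrm{LR}(s_{-i})=\prod_{k\ne i}\frac{s_k}{1-s_k}$, $\mathrm{LR}(s_i,s_{-i})=\prod_k\frac{s_k}{1-s_k}$.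 A mechanism is a measurable $x:[\underline s,\overline s]^n\to[0,1]^n$ ($x_i(s)$ = probability agent $i$ gets a good worth $\omega$ to her, else payoff $0$). Feasibility for agent $i$: for all $s_i,\hat s_i$ in the support, (P) $\mathbb E[\omega x_i(s_i,s_{-i})\mid s_i]\ge0$ and (IC) $\mathbb E[\omega x_i(s_i,s_{-i})\mid s_i]\ge\mathbb E[\omega x_i(\hat s_i,s_{-i})\mid s_i]$. An optimal mechanism for agent $i$ maximizes $\mathbb E[x_i(s)]$ subject to (P) and (IC) for agent $i$. Monotone threshold mechanism: there is a partition $\mathcal S_i$ of $[\underline s,\overline s]$ into disjoint intervals such that on each $S\in\mathcal S_i$, $x_i(s_i,s_{-i})=\kappa\,\mathbb I\{\mathrm{LR}(s_{-i})\ge\tau\}$ for some $\kappa\in[0,1]$, $\tau\ge0$ (depending on $S$; for singleton intervals $S=\{s_i\}$ this includes $\tau=\mathrm{LR}(s_i)^{-1}$). *)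

theory Defs
  imports "HOL-Probability.Probability"
begin

text \<open>Signals live in [a,b] (a subset of [0,1]); agents are indexed by {..<n};
  a signal profile is a function nat => real (extensional on {..<n}).
  The unconditional signal density is f (on [a,b]); the normalization
  s_i = P[omega=+1 | s_i] with uniform prior forces the conditional densities
  2 s f(s) (state +1) and 2 (1-s) f(s) (state -1).\<close>

definition lr :: "real \<Rightarrow> ereal" where
  "lr s = (if s = 1 then \<infinity> else ereal (s / (1 - s)))"

definition LRset :: "(nat \<Rightarrow> real) \<Rightarrow> nat set \<Rightarrow> ereal" where
  "LRset s K = (\<Prod>k\<in>K. lr (s k))"

definition Fplus :: "real \<Rightarrow> real \<Rightarrow> (real \<Rightarrow> real) \<Rightarrow> real measure" where
  "Fplus a b f = density lborel (\<lambda>s. ennreal (indicator {a..b} s * (2 * s * f s)))"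

definition Fminus :: "real \<Rightarrow> real \<Rightarrow> (real \<Rightarrow> real) \<Rightarrow> real measure" where
  "Fminus a b f = density lborel (\<lambda>s. ennreal (indicator {a..b} s * (2 * (1 - s) * f s)))"

definition others :: "nat \<Rightarrow> nat \<Rightarrow> real measure \<Rightarrow> (nat \<Rightarrow> real) measure" where
  "others n i M = PiM ({..<n} - {i}) (\<lambda>_. M)"

definition others_box :: "real \<Rightarrow> real \<Rightarrow> nat \<Rightarrow> nat \<Rightarrow> (nat \<Rightarrow> real) set" where
  "others_box a b n i = PiE ({..<n} - {i}) (\<lambda>_. {a..b})"

text \<open>E[omega x_i(t, s_{-i}) | s_i = u]  (true signal u, report t).\<close>
definition interim_util ::
  "real \<Rightarrow> real \<Rightarrow> (real \<Rightarrow> real) \<Rightarrow> nat \<Rightarrow> ((nat \<Rightarrow> real) \<Rightarrow> nat \<Rightarrow> real) \<Rightarrow> nat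
    \<Rightarrow> real \<Rightarrow> real \<Rightarrow> real" where
  "interim_util a b f n x i u t =
     u * (\<integral>y. x (y(i := t)) i \<partial>others n i (Fplus a b f))
     - (1 - u) * (\<integral>y. x (y(i := t)) i \<partial>others n i (Fminus a b f))"

definition is_mechanism :: "real \<Rightarrow> real \<Rightarrow> nat \<Rightarrow> ((nat \<Rightarrow> real) \<Rightarrow> nat \<Rightarrow> real) \<Rightarrow> bool" where
  "is_mechanism a b n x \<longleftrightarrow>
     (\<forall>i<n. (\<lambda>s. x s i) \<in> borel_measurable (PiM {..<n} (\<lambda>_. lborel))) \<and>
     (\<forall>s\<in>PiE {..<n} (\<lambda>_. {a..b}). \<forall>i<n. x s i \<in> {0..1})"

definition feasible ::
  "real \<Rightarrow> real \<Rightarrow> (real \<Rightarrow> real) \<Rightarrow> nat \<Rightarrow> ((nat \<Rightarrow> real) \<Rightarrow> nat \<Rightarrow> real) \<Rightarrow> nat \<Rightarrow> bool" where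
  "feasible a b f n x i \<longleftrightarrow>
     (\<forall>u\<in>{a..b}. interim_util a b f n x i u u \<ge> 0) \<and>
     (\<forall>u\<in>{a..b}. \<forall>t\<in>{a..b}. interim_util a b f n x i u u \<ge> interim_util a b f n x i u t)"

text \<open>E[x_i(s)] under the uniform prior over the state.\<close>
definition ex_alloc ::
  "real \<Rightarrow> real \<Rightarrow> (real \<Rightarrow> real) \<Rightarrow> nat \<Rightarrow> ((nat \<Rightarrow> real) \<Rightarrow> nat \<Rightarrow> real) \<Rightarrow> nat \<Rightarrow> real" where
  "ex_alloc a b f n x i =
     (\<integral>s. x s i \<partial>PiM {..<n} (\<lambda>_. Fplus a b f)) / 2 +
     (\<integral>s. x s i \<partial>PiM {..<n} (\<lambda>_. Fminus a b f)) / 2"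

definition optimal_for ::
  "real \<Rightarrow> real \<Rightarrow> (real \<Rightarrow> real) \<Rightarrow> nat \<Rightarrow> nat \<Rightarrow> ((nat \<Rightarrow> real) \<Rightarrow> nat \<Rightarrow> real) \<Rightarrow> bool" where
  "optimal_for a b f n i x \<longleftrightarrow>
     is_mechanism a b n x \<and> feasible a b f n x i \<and>
     (\<forall>y. is_mechanism a b n y \<and> feasible a b f n y i \<longrightarrow> ex_alloc a b f n y i \<le> ex_alloc a b f n x i)"

definition interval_partition :: "real \<Rightarrow> real \<Rightarrow> real set set \<Rightarrow> bool" where
  "interval_partition a b P \<longleftrightarrow>
     (\<forall>S\<in>P. S \<noteq> {} \<and> is_interval S) \<and> pairwise disjnt P \<and> \<Union>P = {a..b}"

definition admissible_tau :: "real set \<Rightarrow> ereal \<Rightarrow> bool" where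
  "admissible_tau S \<tau> \<longleftrightarrow> 0 \<le> \<tau> \<and> (\<tau> \<noteq> \<infinity> \<or> (\<exists>u. S = {u} \<and> \<tau> = inverse (lr u)))"

definition threshold_form ::
  "real \<Rightarrow> real \<Rightarrow> nat \<Rightarrow> ((nat \<Rightarrow> real) \<Rightarrow> nat \<Rightarrow> real) \<Rightarrow> nat \<Rightarrow> real set \<Rightarrow> real \<Rightarrow> ereal \<Rightarrow> bool" where
  "threshold_form a b n x i S \<kappa> \<tau> \<longleftrightarrow>
     (\<forall>u\<in>S. \<forall>y\<in>others_box a b n i.
        x (y(i := u)) i = \<kappa> * (if LRset y ({..<n} - {i}) \<ge> \<tau> then 1 else 0))"

definition monotone_threshold ::
  "real \<Rightarrow> real \<Rightarrow> nat \<Rightarrow> ((nat \<Rightarrow> real) \<Rightarrow> nat \<Rightarrow> real) \<Rightarrow> nat \<Rightarrow> real set set \<Rightarrow> bool" where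
  "monotone_threshold a b n x i P \<longleftrightarrow>
     interval_partition a b P \<and>
     (\<forall>S\<in>P. \<exists>\<kappa>\<in>{0..1}. \<exists>\<tau>. admissible_tau S \<tau> \<and> threshold_form a b n x i S \<kappa> \<tau>)"

definition adjacent :: "real set \<Rightarrow> real set \<Rightarrow> bool" where
  "adjacent S T \<longleftrightarrow> S \<noteq> T \<and> is_interval (S \<union> T)"

definition deterministic_threshold_on ::
  "real \<Rightarrow> real \<Rightarrow> nat \<Rightarrow> ((nat \<Rightarrow> real) \<Rightarrow> nat \<Rightarrow> real) \<Rightarrow> nat \<Rightarrow> real set \<Rightarrow> bool" where
  "deterministic_threshold_on a b n x i S \<longleftrightarrow>
     (\<exists>\<kappa>\<in>{0, 1}. \<exists>\<tau>. admissible_tau S \<tau> \<and> threshold_form a b n x i S \<kappa> \<tau>)"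

end

theory Submission
  imports Defs "HOL-Complex_Analysis.Great_Picard"
begin

text \<open>A report \<open>t\<close> buys a pair \<open>(p, q)\<close>, the allocation probabilities conditional on the two
  states, and gives type \<open>v\<close> the utility \<open>v p - (1 - v) q\<close>, which is affine in \<open>v\<close>. So incentive compatible
  mechanisms are convex interim utilities \<open>U\<close>, with the bought lines as subgradients. By the
  Neyman-Pearson lemma the available lines are those below the first-best utility \<open>V\<close>, which is
  continuously differentiable because the likelihood ratio has no atoms. After adding the options "never" and
  "always", \<open>U\<close> ranges over the convex functions between \<open>max 0 (2 v - 1)\<close> and \<open>V\<close>, a compact convex set,
  and integration by parts turns the objective into a continuous linear functional of \<open>U\<close>.

  Take a maximizer that is an extreme point. Where \<open>U = V\<close> the item is the first-best one, and a line
  touching \<open>V\<close> is a deterministic threshold item. Where \<open>U < V\<close>, a perturbation argument shows that \<open>U\<close> is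
  piecewise affine, and that of two adjacent pieces at least one lies on a line touching \<open>V\<close>. The
  partition consists of the level sets of the right derivative of \<open>U\<close>; those that contain no rational are
  singletons on which \<open>U = V\<close>, and the other level sets are countably many.\<close>

section \<open>Subgradients and integration by parts\<close>

text \<open>The integrand of the objective contains the slope of \<open>U\<close>, which at a kink
  depends on the option that is bought. Integration by parts removes the slope, at the price of
  differentiating the density, and the objective then sees \<open>U\<close> only. They meet
  \<open>V\<close> at the types 0 and 1, so all candidates agree at both ends and have slopes in
  \<open>[0, 2]\<close>, which gives compactness; this is why types range over \<open>[0, 1]\<close>
  although signals only fill \<open>[a, b]\<close>. A perturbation has to vanish at both ends of a
  region where \<open>U < V\<close>, so one group of slopes cannot be raised unless another is
  lowered. At an extreme point no two groups of slopes inside such a region can be free, and this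
  one fact yields both the affine pieces and the statement on adjacent pieces. Differentiability of
  \<open>V\<close> makes the line that touches it at a given type unique, so a touching line is the
  first-best item of that type and hence deterministic.\<close>

definition subgrad_on :: "real set \<Rightarrow> (real \<Rightarrow> real) \<Rightarrow> (real \<Rightarrow> real) \<Rightarrow> bool" where
  "subgrad_on S U m \<longleftrightarrow> (\<forall>s\<in>S. \<forall>t\<in>S. U s + m s * (t - s) \<le> U t)"

lemma subgrad_onD: "subgrad_on S U m \<Longrightarrow> s \<in> S \<Longrightarrow> t \<in> S \<Longrightarrow> U s + m s * (t - s) \<le> U t"
  by (simp add: subgrad_on_def)

lemma subgrad_on_subset: "subgrad_on S U m \<Longrightarrow> T \<subseteq> S \<Longrightarrow> subgrad_on T U m"
  by (auto simp: subgrad_on_def)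

lemma subgrad_on_mono:
  assumes "subgrad_on S U m"
  shows "mono_on S m"
proof (rule mono_onI)
  fix s t assume "s \<in> S" "t \<in> S" "s \<le> t"
  show "m s \<le> m t"
  proof (cases "s = t")
    case False
    with subgrad_onD[OF assms \<open>s \<in> S\<close> \<open>t \<in> S\<close>] subgrad_onD[OF assms \<open>t \<in> S\<close> \<open>s \<in> S\<close>]
    have "m s * (t - s) \<le> m t * (t - s)" by (simp add: algebra_simps)
    with False \<open>s \<le> t\<close> show ?thesis by simp
  qed simp
qed

lemma subgrad_on_lipschitz:
  assumes "subgrad_on S U m" "\<And>s. s \<in> S \<Longrightarrow> \<bar>m s\<bar> \<le> C" "s \<in> S" "t \<in> S"
  shows "\<bar>U t - U s\<bar> \<le> C * \<bar>t - s\<bar>"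
proof -
  have 1: "\<bar>m x * (t - s)\<bar> \<le> C * \<bar>t - s\<bar>" if "x \<in> S" for x
    using assms(2)[OF that] by (simp add: abs_mult mult_right_mono)
  show ?thesis
    using subgrad_onD[OF assms(1,3,4)] subgrad_onD[OF assms(1,4,3)] 1[OF assms(3)] 1[OF assms(4)]
    by (simp add: algebra_simps abs_le_iff)
qed

lemma lipschitz_imp_continuous_on:
  fixes U :: "real \<Rightarrow> real"
  assumes "\<And>s t. s \<in> S \<Longrightarrow> t \<in> S \<Longrightarrow> \<bar>U t - U s\<bar> \<le> C * \<bar>t - s\<bar>"
  shows "continuous_on S U"
proof -
  have "(max C 0)-lipschitz_on S U"
  proof (rule lipschitz_onI)
    fix x y assume "x \<in> S" "y \<in> S"
    have "dist (U x) (U y) \<le> C * dist x y"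
      using assms[OF \<open>y \<in> S\<close> \<open>x \<in> S\<close>] by (simp add: dist_real_def)
    also have "\<dots> \<le> max C 0 * dist x y" by (intro mult_right_mono) auto
    finally show "dist (U x) (U y) \<le> max C 0 * dist x y" .
  qed simp
  thus ?thesis by (rule lipschitz_on_continuous_on)
qed

text \<open>Over \<open>n\<close> equal steps the bounds telescope to
  \<open>(w b - w a) * (b - a) / n\<close>, which is arbitrarily small. This replaces
  almost-everywhere differentiation in the integral formulas below, where \<open>w\<close> is the
  slope itself or a linear function.\<close>

lemma increment_bound_imp_constant:
  fixes g w :: "real \<Rightarrow> real"
  assumes "a \<le> b"
    and inc: "\<And>x y. a \<le> x \<Longrightarrow> x \<le> y \<Longrightarrow> y \<le> b \<Longrightarrow> \<bar>g y - g x\<bar> \<le> (w y - w x) * (y - x)"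
  shows "g b = g a"
proof (rule ccontr)
  assume "g b \<noteq> g a"
  define e where "e = \<bar>g b - g a\<bar>"
  have "e > 0" using \<open>g b \<noteq> g a\<close> by (simp add: e_def)
  obtain n :: nat where n: "real n > (w b - w a) * (b - a) / e" "n > 0"
    using reals_Archimedean2[of "max 0 ((w b - w a) * (b - a) / e)"]
    by (metis max_less_iff_conj of_nat_0_less_iff)
  define x where "x k = a + real k * ((b - a) / n)" for k :: nat
  have x0: "x 0 = a" and xn: "x n = b" using n by (auto simp: x_def)
  have dx: "x (Suc k) - x k = (b - a) / n" for k by (simp add: x_def distrib_right add_divide_distrib)
  have step: "\<bar>g (x (Suc k)) - g (x k)\<bar> \<le> (w (x (Suc k)) - w (x k)) * ((b - a) / n)" if "k < n" for k
  proof -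
    have "real (Suc k) * ((b - a) / n) \<le> real n * ((b - a) / n)"
      using that \<open>a \<le> b\<close> by (intro mult_right_mono) auto
    hence "x (Suc k) \<le> b" using xn by (simp add: x_def)
    moreover have "a \<le> x k" using \<open>a \<le> b\<close> by (simp add: x_def)
    moreover have "x k \<le> x (Suc k)" using dx[of k] \<open>a \<le> b\<close>
      by (metis diff_ge_0_iff_ge divide_nonneg_nonneg of_nat_0_le_iff)
    ultimately show ?thesis using inc[of "x k" "x (Suc k)"] dx[of k] by simp
  qed
  have "e = \<bar>\<Sum>k<n. g (x (Suc k)) - g (x k)\<bar>"
    unfolding e_def by (subst sum_lessThan_telescope) (simp add: x0 xn)
  also have "\<dots> \<le> (\<Sum>k<n. \<bar>g (x (Suc k)) - g (x k)\<bar>)" by (rule sum_abs)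
  also have "\<dots> \<le> (\<Sum>k<n. (w (x (Suc k)) - w (x k)) * ((b - a) / n))"
    by (intro sum_mono step) auto
  also have "\<dots> = (w b - w a) * ((b - a) / n)"
    unfolding sum_distrib_right[symmetric]
    using sum_lessThan_telescope[of "\<lambda>k. w (x k)" n] by (simp add: x0 xn)
  finally have "e * n \<le> (w b - w a) * (b - a)" using n by (simp add: field_simps)
  with n \<open>e > 0\<close> show False by (simp add: field_simps)
qed

text \<open>On \<open>[x, y]\<close> both \<open>U y - U x\<close> and the integral of
  \<open>m\<close> lie between \<open>m x * (y - x)\<close> and \<open>m y * (y - x)\<close>, so
  \<open>increment_bound_imp_constant\<close> applies with \<open>w = m\<close>. This covers kinks
  of \<open>U\<close>.\<close>

lemma subgrad_on_has_integral:
  assumes sg: "subgrad_on {a..b} U m" and "a \<le> b"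
  shows "(m has_integral (U b - U a)) {a..b}"
proof -
  have mono: "mono_on {a..b} m" by (rule subgrad_on_mono[OF sg])
  have int: "m integrable_on {x..y}" if "a \<le> x" "y \<le> b" for x y
    using that by (intro integrable_on_mono_on monotone_on_subset[OF mono]) auto
  define g where "g x = U x - integral {a..x} m" for x
  have "g b = g a"
  proof (rule increment_bound_imp_constant[OF \<open>a \<le> b\<close>])
    fix x y assume xy: "a \<le> x" "x \<le> y" "y \<le> b"
    have "integral {a..x} m + integral {x..y} m = integral {a..y} m"
      by (rule Henstock_Kurzweil_Integration.integral_combine) (use xy int in auto)
    hence gd: "g y - g x = U y - U x - integral {x..y} m" by (simp add: g_def)
    have "integral {x..y} (\<lambda>_. m x) \<le> integral {x..y} m"
      using xy by (intro integral_le int) (auto intro!: mono_onD[OF mono])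
    moreover have "integral {x..y} m \<le> integral {x..y} (\<lambda>_. m y)"
      using xy by (intro integral_le int) (auto intro!: mono_onD[OF mono])
    moreover have "U x + m x * (y - x) \<le> U y" "U y + m y * (x - y) \<le> U x"
      using xy by (auto intro!: subgrad_onD[OF sg])
    ultimately show "\<bar>g y - g x\<bar> \<le> (m y - m x) * (y - x)"
      unfolding gd using xy by (simp add: algebra_simps abs_le_iff)
  qed
  hence "integral {a..b} m = U b - U a" by (simp add: g_def)
  thus ?thesis using int[of a b] by (metis integrable_integral order_refl)
qed

lemma set_integrable_bounded_Icc:
  fixes g :: "real \<Rightarrow> real"
  assumes "g \<in> borel_measurable (restrict_space borel {a..b})" "\<And>x. x \<in> {a..b} \<Longrightarrow> \<bar>g x\<bar> \<le> C"
  shows "set_integrable lborel {a..b} g"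
  unfolding set_integrable_def
proof (rule integrableI_bounded_set[where A = "{a..b}" and B = C])
  show "(\<lambda>x. indicator {a..b} x *\<^sub>R g x) \<in> borel_measurable lborel"
    using assms(1) by (simp add: borel_measurable_restrict_space_iff)
  show "emeasure lborel {a..b} < \<infinity>" by (simp add: emeasure_lborel_Icc_eq)
  show "AE x \<in> {a..b} in lborel. norm (indicator {a..b} x *\<^sub>R g x) \<le> C"
    using assms(2) by (intro AE_I2) (auto simp: indicator_def)
qed auto

text \<open>The product rule across kinks: over \<open>[x, y]\<close> the difference between
  \<open>F * U\<close> and the integral of the candidate derivative changes by at most
  \<open>2 * K * C * (y - x)^2\<close>, so \<open>increment_bound_imp_constant\<close> applies with
  a linear \<open>w\<close>.\<close>

lemma subgrad_on_integral_by_parts: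
  assumes sg: "subgrad_on {a..b} U m" and C: "\<And>s. s \<in> {a..b} \<Longrightarrow> \<bar>m s\<bar> \<le> C" and "a \<le> b"
    and F: "\<And>s. s \<in> {a..b} \<Longrightarrow> (F has_real_derivative F' s) (at s within {a..b})"
    and F': "continuous_on {a..b} F'"
  shows "set_integrable lborel {a..b} (\<lambda>s. F s * m s)"
    and "((\<lambda>s. F' s * U s + F s * m s) has_integral (F b * U b - F a * U a)) {a..b}"
proof -
  have mono: "mono_on {a..b} m" by (rule subgrad_on_mono[OF sg])
  have cU: "continuous_on {a..b} U"
    by (rule lipschitz_imp_continuous_on[OF subgrad_on_lipschitz[OF sg C]])
  have cF: "continuous_on {a..b} F"
    using F by (meson DERIV_continuous continuous_on_eq_continuous_within)
  have "C \<ge> 0" using C[of a] \<open>a \<le> b\<close> by fastforce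
  obtain K where K: "\<And>s. s \<in> {a..b} \<Longrightarrow> \<bar>F' s\<bar> \<le> K"
    using compact_imp_bounded[OF compact_continuous_image[OF F' compact_Icc]]
    by (force simp: bounded_iff)
  have "K \<ge> 0" using K[of a] \<open>a \<le> b\<close> by fastforce
  obtain K0 where K0: "\<And>s. s \<in> {a..b} \<Longrightarrow> \<bar>F s\<bar> \<le> K0"
    using compact_imp_bounded[OF compact_continuous_image[OF cF compact_Icc]]
    by (force simp: bounded_iff)
  have meas: "m \<in> borel_measurable (restrict_space borel {a..b})"
    using mono by (rule borel_measurable_mono_on_fnc)
  have measF: "F \<in> borel_measurable (restrict_space borel {a..b})"
    using cF by (rule borel_measurable_continuous_on_restrict)
  show si: "set_integrable lborel {a..b} (\<lambda>s. F s * m s)"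
  proof (rule set_integrable_bounded_Icc)
    show "(\<lambda>s. F s * m s) \<in> borel_measurable (restrict_space borel {a..b})"
      using meas measF by simp
    show "\<bar>F s * m s\<bar> \<le> K0 * C" if "s \<in> {a..b}" for s
      using K0[OF that] C[OF that] by (simp add: abs_mult mult_mono')
  qed
  have intFm: "(\<lambda>s. F s * m s) integrable_on {x..y}" if "a \<le> x" "y \<le> b" for x y
    using that by (intro integrable_subinterval_real[OF set_borel_integral_eq_integral(1)[OF si]]) auto
  have intF'U: "(\<lambda>s. F' s * U s) integrable_on {x..y}" if "a \<le> x" "y \<le> b" for x y
    using that by (intro integrable_continuous_interval continuous_intros
        continuous_on_subset[OF cU] continuous_on_subset[OF F']) auto
  have intm: "m integrable_on {x..y}" if "a \<le> x" "y \<le> b" for x y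
    using that by (intro integrable_on_mono_on monotone_on_subset[OF mono]) auto
  have intF': "(F' has_integral (F y - F x)) {x..y}" if "a \<le> x" "x \<le> y" "y \<le> b" for x y
    using that by (intro fundamental_theorem_of_calculus)
      (auto simp: has_real_derivative_iff_has_vector_derivative[symmetric]
        intro!: DERIV_subset[OF F])
  define h where "h s = F' s * U s + F s * m s" for s
  have inth: "h integrable_on {x..y}" if "a \<le> x" "y \<le> b" for x y
    unfolding h_def using intF'U[OF that] intFm[OF that] by (rule integrable_add)
  have LF: "\<bar>F t - F s\<bar> \<le> K * \<bar>t - s\<bar>" if "s \<in> {a..b}" "t \<in> {a..b}" for s t
    using field_differentiable_bound[of "{a..b}" F F' K s t] F K that
    by (auto simp: abs_minus_commute)
  define g where "g x = F x * U x - integral {a..x} h" for x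
  have "g b = g a"
  proof (rule increment_bound_imp_constant[OF \<open>a \<le> b\<close>])
    fix x y assume xy: "a \<le> x" "x \<le> y" "y \<le> b"
    have comb: "integral {a..x} h + integral {x..y} h = integral {a..y} h"
      by (rule Henstock_Kurzweil_Integration.integral_combine) (use xy inth in auto)
    have mi: "(m has_integral (U y - U x)) {x..y}"
      using xy by (intro subgrad_on_has_integral subgrad_on_subset[OF sg]) auto
    \<comment> \<open>Freezing \<open>F\<close> at \<open>y\<close> and \<open>U\<close> at
      \<open>x\<close> gives an integrand whose integral is exactly
      \<open>F y * U y - F x * U x\<close>; it differs from \<open>h\<close> by at most
      \<open>2 * K * C * (y - x)\<close> pointwise.\<close>
    have "((\<lambda>s. F y * m s + U x * F' s) has_integral (F y * (U y - U x) + U x * (F y - F x))) {x..y}"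
      by (intro has_integral_add has_integral_mult_right mi intF' xy)
    from has_integral_diff[OF this integrable_integral[OF inth[OF xy(1,3)]]]
    moreover have "F y * (U y - U x) + U x * (F y - F x) - integral {x..y} h = g y - g x"
      using comb by (simp add: g_def algebra_simps)
    ultimately have hi: "((\<lambda>s. F y * m s + U x * F' s - h s) has_integral (g y - g x)) {x..y}"
      by simp
    have "norm (g y - g x) \<le> (2 * K * C * (y - x)) * Sigma_Algebra.measure lborel (cbox x y)"
    proof (rule has_integral_bound[OF _ hi[folded cbox_interval]])
      show "0 \<le> 2 * K * C * (y - x)" using \<open>K \<ge> 0\<close> \<open>C \<ge> 0\<close> xy by simp
      fix s assume "s \<in> cbox x y"
      hence s: "x \<le> s" "s \<le> y" by auto
      have e: "F y * m s + U x * F' s - h s = (F y - F s) * m s + (U x - U s) * F' s"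
        by (simp add: h_def algebra_simps)
      have "\<bar>F y - F s\<bar> \<le> K * (y - x)"
        using LF[of s y] s xy mult_left_mono[of "y - s" "y - x" K] \<open>K \<ge> 0\<close> by auto
      hence 1: "\<bar>(F y - F s) * m s\<bar> \<le> K * (y - x) * C"
        unfolding abs_mult using s xy \<open>K \<ge> 0\<close> by (intro mult_mono C) auto
      have "\<bar>U x - U s\<bar> \<le> C * (y - x)"
        using subgrad_on_lipschitz[OF sg C, of s x] s xy mult_left_mono[of "s - x" "y - x" C] \<open>C \<ge> 0\<close>
        by auto
      hence 2: "\<bar>(U x - U s) * F' s\<bar> \<le> C * (y - x) * K"
        unfolding abs_mult using s xy \<open>C \<ge> 0\<close> by (intro mult_mono K) auto
      show "norm (F y * m s + U x * F' s - h s) \<le> 2 * K * C * (y - x)"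
        unfolding e using 1 2 by (simp add: algebra_simps)
    qed
    thus "\<bar>g y - g x\<bar> \<le> (2 * K * C * y - 2 * K * C * x) * (y - x)"
      using xy by (simp add: algebra_simps)
  qed
  hence "integral {a..b} h = F b * U b - F a * U a" by (simp add: g_def)
  with integrable_integral[OF inth[of a b]] show "((\<lambda>s. F' s * U s + F s * m s) has_integral (F b * U b - F a * U a)) {a..b}"
    by (simp add: h_def[abs_def])
qed

section \<open>The reduced screening problem\<close>

text \<open>Converse of \<open>subgrad_on_has_integral\<close>. It turns a perturbed slope into a
  perturbed convex utility, with monotonicity as the only thing to check.\<close>

lemma indefinite_integral_subgrad_on:
  fixes m :: "real \<Rightarrow> real"
  assumes "mono_on {a..b} m"
  shows "subgrad_on {a..b} (\<lambda>x. c + integral {a..x} m) m"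
  unfolding subgrad_on_def
proof (intro ballI)
  fix s t assume s: "s \<in> {a..b}" and t: "t \<in> {a..b}"
  have int: "m integrable_on {x..y}" if "a \<le> x" "y \<le> b" for x y
    using that by (intro integrable_on_mono_on monotone_on_subset[OF assms]) auto
  show "(c + integral {a..s} m) + m s * (t - s) \<le> c + integral {a..t} m"
  proof (cases "s \<le> t")
    case True
    have "integral {a..s} m + integral {s..t} m = integral {a..t} m"
      by (rule Henstock_Kurzweil_Integration.integral_combine) (use s t True int in auto)
    moreover have "integral {s..t} (\<lambda>_. m s) \<le> integral {s..t} m"
      using s t by (intro integral_le int) (auto intro!: mono_onD[OF assms])
    ultimately show ?thesis using True by (simp add: algebra_simps)
  next
    case False
    hence "integral {a..t} m + integral {t..s} m = integral {a..s} m"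
      by (intro Henstock_Kurzweil_Integration.integral_combine) (use s t int in auto)
    moreover have "integral {t..s} m \<le> integral {t..s} (\<lambda>_. m s)"
      using s t by (intro integral_le int) (auto intro!: mono_onD[OF assms])
    ultimately show ?thesis using False by (simp add: algebra_simps)
  qed
qed

lemma subgrad_on_imp_convex_on:
  assumes sg: "subgrad_on S U m" and "convex S"
  shows "convex_on S U"
proof (rule convex_onI)
  fix t x y :: real assume t: "0 < t" "t < 1" and xy: "x \<in> S" "y \<in> S"
  define z where "z = (1 - t) * x + t * y"
  have z: "z \<in> S" using convexD[OF \<open>convex S\<close> xy, of "1 - t" t] t by (simp add: z_def)
  have "(1 - t) * (U z + m z * (x - z)) + t * (U z + m z * (y - z)) \<le> (1 - t) * U x + t * U y"
    using t by (intro add_mono mult_left_mono subgrad_onD[OF sg] z xy) auto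
  also have "(1 - t) * (U z + m z * (x - z)) + t * (U z + m z * (y - z)) = U z"
    by (simp add: z_def algebra_simps)
  finally show "U ((1 - t) *\<^sub>R x + t *\<^sub>R y) \<le> (1 - t) * U x + t * U y" by (simp add: z_def)
qed fact

text \<open>Compactness is only used for the set of values in the reals, so no topology on functions
  is set up. The lemma serves twice: for the objective, and for the integral of the square over its
  maximizers.\<close>

lemma attains_max_of_seq_compact:
  fixes F :: "'a \<Rightarrow> real"
  assumes "C \<noteq> {}"
    and sub: "\<And>W :: nat \<Rightarrow> 'a. (\<And>n. W n \<in> C) \<Longrightarrow>
           \<exists>g\<in>C. \<exists>k. strict_mono k \<and> (\<lambda>n. F (W (k n))) \<longlonglongrightarrow> F g"
  shows "\<exists>U\<in>C. \<forall>W\<in>C. F W \<le> F U"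
proof -
  have "compact (F ` C)"
    unfolding compact_def
  proof (intro allI impI)
    fix f :: "nat \<Rightarrow> real" assume "\<forall>n. f n \<in> F ` C"
    hence "\<exists>W. \<forall>n. W n \<in> C \<and> f n = F (W n)"
      by (intro choice) auto
    then obtain W where W: "\<And>n. W n \<in> C" "\<And>n. f n = F (W n)"
      by blast
    from sub[of W, OF W(1)] obtain g k where "g \<in> C" "strict_mono (k :: nat \<Rightarrow> nat)" "(\<lambda>n. F (W (k n))) \<longlonglongrightarrow> F g"
      by blast
    moreover have "f \<circ> k = (\<lambda>n. F (W (k n)))" using W(2) by (simp add: fun_eq_iff)
    ultimately show "\<exists>l\<in>F ` C. \<exists>r. strict_mono r \<and> (f \<circ> r) \<longlonglongrightarrow> l"
      by (intro bexI[of _ "F g"] exI[of _ k]) simp_all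
  qed
  from compact_attains_sup[OF this] \<open>C \<noteq> {}\<close> show ?thesis by auto
qed

text \<open>\<open>A \<theta>\<close> and \<open>B \<theta>\<close> stand for the conditional probabilities, given the good and the bad state, that
  \<open>LR(\<theta>, s') \<ge> 1\<close>.\<close>
locale screening =
  fixes A B :: "real \<Rightarrow> real"
  assumes contA: "continuous_on {0..1} A" and contB: "continuous_on {0..1} B"
    and ends: "A 0 = 0" "B 0 = 0" "A 1 = 1" "B 1 = 1"
    and NP: "\<And>\<theta> v. \<theta> \<in> {0..1} \<Longrightarrow> v \<in> {0..1} \<Longrightarrow> v * A \<theta> - (1 - v) * B \<theta> \<le> v * A v - (1 - v) * B v"
begin

section \<open>First-best utility and the items whose lines lie below it\<close>

definition V :: "real \<Rightarrow> real" where "V v = v * A v - (1 - v) * B v"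

lemma V_ends: "V 0 = 0" "V 1 = 1"
  by (simp_all add: V_def ends)

lemma contV: "continuous_on {0..1} V"
  unfolding V_def by (intro continuous_intros contA contB)

lemma V_lower: "v \<in> {0..1} \<Longrightarrow> 0 \<le> V v" "v \<in> {0..1} \<Longrightarrow> 2 * v - 1 \<le> V v"
  using NP[of 0 v] NP[of 1 v] by (auto simp: V_def ends)

lemma subgrad_V: "subgrad_on {0..1} V (\<lambda>v. A v + B v)"
  unfolding subgrad_on_def
proof (intro ballI)
  fix s t :: real assume "s \<in> {0..1}" "t \<in> {0..1}"
  from NP[OF this] show "V s + (A s + B s) * (t - s) \<le> V t"
    by (simp add: V_def algebra_simps)
qed

text \<open>\<open>V\<close> has the continuous subgradient \<open>A + B\<close>, so a line below
  \<open>V\<close> that touches it at an interior \<open>\<theta>\<close> has slope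
  \<open>A \<theta> + B \<theta>\<close>; value and slope determine \<open>p\<close> and
  \<open>q\<close>.\<close>

lemma touching_line:
  assumes pq: "0 \<le> q" "q \<le> p" "p \<le> 1"
    and le: "\<And>v. v \<in> {0..1} \<Longrightarrow> v * p - (1 - v) * q \<le> V v"
    and \<theta>: "\<theta> \<in> {0..1}" and eq: "\<theta> * p - (1 - \<theta>) * q = V \<theta>"
  shows "p = A \<theta> \<and> q = B \<theta>"
proof -
  define M where "M v = A v + B v" for v
  have contM: "continuous_on {0..1} M" unfolding M_def by (intro continuous_intros contA contB)
  \<comment> \<open>Type \<open>v\<close> weakly prefers its first-best item to
    \<open>(p, q)\<close>, and \<open>\<theta>\<close> weakly prefers \<open>(p, q)\<close> to that
    item; subtracting compares the slopes.\<close>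
  have key: "(v - \<theta>) * (p + q) \<le> (v - \<theta>) * M v" if "v \<in> {0..1}" for v
    using le[OF that] NP[OF that \<theta>] eq by (simp add: V_def M_def algebra_simps)
  have up: "p + q \<le> M \<theta>" if "\<theta> < 1"
  proof (rule continuous_ge_on_closure[where f = M and x = \<theta> and S = "{\<theta><..<1}"])
    show "continuous_on (closure {\<theta><..<1}) M"
      using \<theta> that by (auto intro: continuous_on_subset[OF contM])
    show "\<theta> \<in> closure {\<theta><..<1}" using that by simp
    show "p + q \<le> M v" if "v \<in> {\<theta><..<1}" for v
      using key[of v] that \<theta> by auto
  qed
  have lo: "M \<theta> \<le> p + q" if "\<theta> > 0"
  proof (rule continuous_le_on_closure[where f = M and x = \<theta> and S = "{0<..<\<theta>}"])
    show "continuous_on (closure {0<..<\<theta>}) M"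
      using \<theta> that by (auto intro: continuous_on_subset[OF contM])
    show "\<theta> \<in> closure {0<..<\<theta>}" using that by simp
    show "M v \<le> p + q" if "v \<in> {0<..<\<theta>}" for v
      using key[of v] that \<theta> by (auto simp: mult_le_cancel_left)
  qed
  \<comment> \<open>At an end only one of the two one-sided bounds is available; the order
    \<open>0 \<le> q \<le> p \<le> 1\<close> supplies the rest.\<close>
  consider "\<theta> = 0" | "\<theta> = 1" | "0 < \<theta>" "\<theta> < 1" using \<theta> by fastforce
  thus ?thesis
  proof cases
    case 1 thus ?thesis using up pq by (simp add: M_def ends)
  next
    case 2 thus ?thesis using lo pq eq by (simp add: M_def ends V_def)
  next
    case 3
    hence M: "p + q = M \<theta>" using up lo by auto
    have "q = \<theta> * (p + q) - (\<theta> * p - (1 - \<theta>) * q)" by (simp add: algebra_simps)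
    also have "\<dots> = \<theta> * M \<theta> - V \<theta>" by (simp only: M eq)
    also have "\<dots> = B \<theta>" by (simp add: M_def V_def algebra_simps)
    finally have "q = B \<theta>" .
    with M show ?thesis by (simp add: M_def)
  qed
qed

text \<open>Moving the cutoff from the one with \<open>A \<theta>\<^sub>0 = p\<close> up to 1, the threshold item passes from
  below to above the ray through \<open>(p, q)\<close>; at the crossing, \<open>(p, q)\<close> is a multiple of it.\<close>
lemma item_as_threshold:
  assumes pq: "0 \<le> q" "q \<le> p" "p \<le> 1"
    and le: "\<And>v. v \<in> {0..1} \<Longrightarrow> v * p - (1 - v) * q \<le> V v"
  shows "\<exists>\<kappa>\<in>{0..1}. \<exists>\<theta>\<in>{0<..1}. p = \<kappa> * A \<theta> \<and> q = \<kappa> * B \<theta>"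
proof (cases "p = 0")
  case True
  with pq show ?thesis by (intro bexI[of _ 0] bexI[of _ 1]) auto
next
  case False
  hence p: "p > 0" using pq by simp
  \<comment> \<open>The smallest element of \<open>Z\<close> is taken so that, in the boundary case
    where it is 1, \<open>A\<close> stays below 1 before it.\<close>
  define Z where "Z = {\<theta>\<in>{0..1}. A \<theta> = p}"
  have "\<exists>x\<ge>0. x \<le> 1 \<and> A x = p"
    by (rule IVT') (use p pq contA ends in auto)
  hence "Z \<noteq> {}" by (auto simp: Z_def)
  moreover have "closed Z" unfolding Z_def
    using continuous_closed_preimage_constant[OF contA] by simp
  moreover have "bounded Z" by (rule bounded_subset[of "{0..1}"]) (auto simp: Z_def)
  ultimately obtain \<theta>0 where \<theta>0: "\<theta>0 \<in> Z" and min: "\<And>\<theta>. \<theta> \<in> Z \<Longrightarrow> \<theta>0 \<le> \<theta>"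
    using compact_attains_inf[of Z] by (auto simp: compact_eq_bounded_closed)
  have t0: "0 \<le> \<theta>0" "\<theta>0 \<le> 1" "A \<theta>0 = p" using \<theta>0 by (auto simp: Z_def)
  \<comment> \<open>The line of \<open>(p, q)\<close> lies below \<open>V\<close> at
    \<open>\<theta>0\<close>, and the terms with \<open>A \<theta>0 = p\<close> cancel; dividing by
    \<open>1 - \<theta>0\<close> requires \<open>\<theta>0 < 1\<close>. For
    \<open>\<theta>0 = 1\<close> the bound \<open>B v \<le> q\<close> is shown for
    \<open>v < 1\<close> and passed to the limit.\<close>
  have B0: "B \<theta>0 \<le> q"
  proof (cases "\<theta>0 < 1")
    case True
    have "(1 - \<theta>0) * B \<theta>0 \<le> (1 - \<theta>0) * q"
      using le[of \<theta>0] t0 by (simp add: V_def)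
    with True show ?thesis by simp
  next
    case False
    hence [simp]: "\<theta>0 = 1" using t0 by simp
    hence p1: "p = 1" using t0 ends by simp
    have Alt: "A \<theta> < 1" if "0 \<le> \<theta>" "\<theta> < 1" for \<theta>
    proof (rule ccontr)
      assume "\<not> A \<theta> < 1"
      hence "\<exists>x\<ge>0. x \<le> \<theta> \<and> A x = p"
        by (intro IVT') (use p p1 that ends in \<open>auto intro: continuous_on_subset[OF contA]\<close>)
      then obtain x where "0 \<le> x" "x \<le> \<theta>" "A x = p" by auto
      with min[of x] that show False by (auto simp: Z_def)
    qed
    show ?thesis unfolding \<open>\<theta>0 = 1\<close>
    proof (rule continuous_le_on_closure[where f = B and x = 1 and S = "{0<..<1}"])
      show "continuous_on (closure {0<..<1}) B" using contB by simp
      show "(1::real) \<in> closure {0<..<1}" by simp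
      show "B v \<le> q" if "v \<in> {0<..<1}" for v
      proof -
        have "v * A v \<le> v" using Alt[of v] that by (simp add: mult_left_le)
        moreover have "v * p - (1 - v) * q \<le> V v" using le that by simp
        ultimately have "(1 - v) * B v \<le> (1 - v) * q" using p1 unfolding V_def by simp
        thus ?thesis using mult_le_cancel_left_pos[of "1 - v" "B v" q] that by simp
      qed
    qed
  qed
  have "\<exists>x\<ge>\<theta>0. x \<le> 1 \<and> p * B x - q * A x = 0"
  proof (rule IVT')
    show "p * B \<theta>0 - q * A \<theta>0 \<le> 0" using B0 t0 p by simp
    show "0 \<le> p * B 1 - q * A 1" using pq ends by simp
    show "continuous_on {\<theta>0..1} (\<lambda>x. p * B x - q * A x)" using t0
      by (intro continuous_intros continuous_on_subset[OF contA] continuous_on_subset[OF contB]) auto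
  qed (use t0 in auto)
  then obtain \<theta> where \<theta>: "\<theta>0 \<le> \<theta>" "\<theta> \<le> 1" "p * B \<theta> = q * A \<theta>" by auto
  have "mono_on {0..1} (\<lambda>v. A v + B v)" by (rule subgrad_on_mono[OF subgrad_V])
  from mono_onD[OF this, of \<theta>0 \<theta>] have mono: "p + B \<theta>0 \<le> A \<theta> + B \<theta>"
    using \<theta> t0 by auto
  \<comment> \<open>At this stage only \<open>A + B\<close> is known to be monotone. If
    \<open>A \<theta>\<close> dropped below \<open>p\<close>, then \<open>B\<close> would rise and
    type \<open>\<theta>\<close> would strictly prefer the cutoff \<open>\<theta>0\<close> to its
    own. The bound makes \<open>p / A \<theta>\<close> a probability.\<close>
  have Age: "p \<le> A \<theta>"
  proof -
    have "\<theta>0 * A \<theta> - (1 - \<theta>0) * B \<theta> \<le> \<theta>0 * p - (1 - \<theta>0) * B \<theta>0" using NP[of \<theta> \<theta>0] \<theta> t0 by auto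
    moreover have "\<theta> * p - (1 - \<theta>) * B \<theta>0 \<le> \<theta> * A \<theta> - (1 - \<theta>) * B \<theta>" using NP[of \<theta>0 \<theta>] \<theta> t0 by auto
    ultimately have 1: "\<theta>0 * (A \<theta> - p) \<le> (1 - \<theta>0) * (B \<theta> - B \<theta>0)"
       and 2: "(1 - \<theta>) * (B \<theta> - B \<theta>0) \<le> \<theta> * (A \<theta> - p)" by (simp_all add: algebra_simps)
    show ?thesis
    proof (rule ccontr)
      assume "\<not> p \<le> A \<theta>"
      hence "B \<theta> > B \<theta>0" using mono by simp
      hence "(1 - \<theta>) * (B \<theta> - B \<theta>0) \<ge> 0" using \<theta> by simp
      hence "\<theta> * (A \<theta> - p) \<ge> 0" using 2 by simp
      with \<open>\<not> p \<le> A \<theta>\<close> \<theta> t0 have "\<theta> = 0" by (auto simp: zero_le_mult_iff)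
      with \<theta> t0 ends p show False by auto
    qed
  qed
  have "\<theta> \<noteq> 0" using Age p ends by auto
  show ?thesis
  proof (rule bexI[of _ "p / A \<theta>"], rule bexI[of _ \<theta>], intro conjI)
    show "\<theta> \<in> {0<..1}" using \<theta> t0 \<open>\<theta> \<noteq> 0\<close> by auto
    show "p / A \<theta> \<in> {0..1}" using Age p by (auto simp: field_simps)
    show "p = p / A \<theta> * A \<theta>" "q = p / A \<theta> * B \<theta>" using Age p \<theta>(3) by (auto simp: field_simps)
  qed
qed

text \<open>At a touching point the item is first best for that type, so the factor is 1; for type 0
  that item is empty and is written with factor 0 and cutoff 1. Cutoff 0 is avoided because
  \<open>inverse (lr 0)\<close> is infinite, which \<open>admissible_tau\<close> allows on
  singletons only.\<close>

lemma item_as_threshold_touching: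
  assumes pq: "0 \<le> q" "q \<le> p" "p \<le> 1"
    and le: "\<And>v. v \<in> {0..1} \<Longrightarrow> v * p - (1 - v) * q \<le> V v"
  shows "\<exists>\<kappa>\<in>{0..1}. \<exists>\<theta>\<in>{0<..1}. p = \<kappa> * A \<theta> \<and> q = \<kappa> * B \<theta> \<and>
           ((\<exists>v\<in>{0..1}. v * p - (1 - v) * q = V v) \<longrightarrow> \<kappa> \<in> {0, 1})"
proof (cases "\<exists>v\<in>{0..1}. v * p - (1 - v) * q = V v")
  case True
  then obtain v where v: "v \<in> {0..1}" "v * p - (1 - v) * q = V v" by blast
  from touching_line[OF pq le this] have pqv: "p = A v" "q = B v" by auto
  show ?thesis
  proof (cases "v = 0")
    case True
    with pqv ends show ?thesis by (intro bexI[of _ 0] bexI[of _ 1]) auto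
  next
    case False
    with pqv v show ?thesis by (intro bexI[of _ 1] bexI[of _ v]) auto
  qed
next
  case False
  with item_as_threshold[OF pq le] show ?thesis by blast
qed

section \<open>Candidate utilities and their right derivatives\<close>

definition G :: "(real \<Rightarrow> real) set" where
  "G = {U. convex_on {0..1} U \<and> (\<forall>v\<in>{0..1}. 0 \<le> U v \<and> 2 * v - 1 \<le> U v \<and> U v \<le> V v)}"

lemma GD:
  assumes "U \<in> G"
  shows "convex_on {0..1} U" "\<And>v. v \<in> {0..1} \<Longrightarrow> 0 \<le> U v" "\<And>v. v \<in> {0..1} \<Longrightarrow> 2 * v - 1 \<le> U v"
    "\<And>v. v \<in> {0..1} \<Longrightarrow> U v \<le> V v" "U 0 = 0" "U 1 = 1"
proof -
  have *: "\<forall>v\<in>{0..1}. 0 \<le> U v \<and> 2 * v - 1 \<le> U v \<and> U v \<le> V v"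
    using assms by (simp add: G_def)
  show "convex_on {0..1} U" using assms by (simp add: G_def)
  show "U 0 = 0" using bspec[OF *, of 0] by (simp add: V_ends)
  show "U 1 = 1" using bspec[OF *, of 1] by (simp add: V_ends)
qed (use assms in \<open>simp_all add: G_def\<close>)

lemma V_in_G: "V \<in> G"
  using subgrad_on_imp_convex_on[OF subgrad_V] V_lower by (simp add: G_def)

text \<open>For convex \<open>U\<close> the slopes from \<open>x\<close> decrease as
  \<open>y\<close> decreases to \<open>x\<close>, so the infimum is the right derivative. At 1 the
  value 2 is the slope of "always", which supports \<open>U\<close> there because
  \<open>2 * v - 1 \<le> U v\<close> and \<open>U 1 = 1\<close>.\<close>

definition rderiv :: "(real \<Rightarrow> real) \<Rightarrow> real \<Rightarrow> real" where
  "rderiv U x = (if x < 1 then INF y\<in>{x<..1}. (U y - U x) / (y - x) else 2)"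

lemma slope_nonneg:
  assumes U: "U \<in> G" and "0 \<le> x" "x < y" "y \<le> 1"
  shows "0 \<le> (U y - U x) / (y - x)"
proof (cases "x = 0")
  case True
  with GD(2)[OF U, of y] GD(5)[OF U] assms show ?thesis by simp
next
  case False
  with assms have x: "0 < x" by simp
  have "(U 0 - U x) / (0 - x) \<le> (U 0 - U y) / (0 - y)"
    using convex_on_slope_le(1)[OF GD(1)[OF U], of 0 y x] assms x by simp
  moreover have "(U 0 - U y) / (0 - y) \<le> (U x - U y) / (x - y)"
    using convex_on_slope_le(2)[OF GD(1)[OF U], of 0 y x] assms x by simp
  moreover have "0 \<le> (U 0 - U x) / (0 - x)" using GD(2)[OF U, of x] GD(5)[OF U] assms by simp
  moreover have "(U x - U y) / (x - y) = (U y - U x) / (y - x)"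
    by (metis minus_diff_eq minus_divide_divide)
  ultimately show ?thesis by simp
qed

lemma rderiv_le_slope:
  assumes U: "U \<in> G" and "0 \<le> x" "x < y" "y \<le> 1"
  shows "rderiv U x \<le> (U y - U x) / (y - x)"
proof -
  have "bdd_below ((\<lambda>y. (U y - U x) / (y - x)) ` {x<..1})"
    by (rule bdd_belowI2[where m = 0]) (use slope_nonneg[OF U \<open>0 \<le> x\<close>] in auto)
  thus ?thesis unfolding rderiv_def using assms by (auto intro!: cINF_lower)
qed

lemma slope_le_rderiv:
  assumes U: "U \<in> G" and "0 \<le> z" "z < x" "x < 1"
  shows "(U x - U z) / (x - z) \<le> rderiv U x"
proof -
  have "(U x - U z) / (x - z) \<le> (U y - U x) / (y - x)" if y: "y \<in> {x<..1}" for y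
  proof -
    have "(U z - U x) / (z - x) \<le> (U z - U y) / (z - y)"
      using convex_on_slope_le(1)[OF GD(1)[OF U], of z y x] assms y by simp
    also have "\<dots> \<le> (U x - U y) / (x - y)"
      using convex_on_slope_le(2)[OF GD(1)[OF U], of z y x] assms y by simp
    also have "\<dots> = (U y - U x) / (y - x)" by (metis minus_diff_eq minus_divide_divide)
    also have "(U z - U x) / (z - x) = (U x - U z) / (x - z)" by (metis minus_diff_eq minus_divide_divide)
    finally show ?thesis .
  qed
  moreover have "{x<..1} \<noteq> {}" using \<open>x < 1\<close> by auto
  ultimately show ?thesis unfolding rderiv_def using \<open>x < 1\<close> by (auto intro!: cINF_greatest)
qed

lemma subgrad_rderiv:
  assumes U: "U \<in> G"
  shows "subgrad_on {0..1} U (rderiv U)"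
  unfolding subgrad_on_def
proof (intro ballI)
  fix s t :: real assume s: "s \<in> {0..1}" and t: "t \<in> {0..1}"
  consider "s = t" | "s < t" | "t < s" "s < 1" | "t < s" "s = 1" using s by fastforce
  thus "U s + rderiv U s * (t - s) \<le> U t"
  proof cases
    case 2
    with rderiv_le_slope[OF U, of s t] s t show ?thesis by (simp add: field_simps)
  next
    case 3
    with slope_le_rderiv[OF U, of t s] s t show ?thesis by (simp add: field_simps)
  next
    case 4
    with GD(3)[OF U t] GD(6)[OF U] show ?thesis by (simp add: rderiv_def)
  qed simp
qed

lemma rderiv_mono: "U \<in> G \<Longrightarrow> mono_on {0..1} (rderiv U)"
  by (rule subgrad_on_mono[OF subgrad_rderiv])

lemma rderiv_bounds:
  assumes U: "U \<in> G" and x: "x \<in> {0..1}"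
  shows "0 \<le> rderiv U x" "rderiv U x \<le> 2"
proof -
  have "0 \<le> rderiv U 0" unfolding rderiv_def
    using slope_nonneg[OF U, of 0] by (auto intro!: cINF_greatest)
  with mono_onD[OF rderiv_mono[OF U], of 0 x] x show "0 \<le> rderiv U x" by simp
  show "rderiv U x \<le> 2"
    using mono_onD[OF rderiv_mono[OF U], of x 1] x by (simp add: rderiv_def)
qed

lemma G_lipschitz:
  assumes "U \<in> G" "s \<in> {0..1}" "t \<in> {0..1}"
  shows "\<bar>U t - U s\<bar> \<le> 2 * \<bar>t - s\<bar>"
  using rderiv_bounds[OF assms(1)]
  by (intro subgrad_on_lipschitz[OF subgrad_rderiv[OF assms(1)] _ assms(2,3)]) auto

lemma G_continuous: "U \<in> G \<Longrightarrow> continuous_on {0..1} U"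
  using G_lipschitz by (intro lipschitz_imp_continuous_on) auto

text \<open>Right continuity of the slope. Some chord from \<open>x\<close> to \<open>y\<close> has
  slope below \<open>c\<close>; moving its left end slightly to the right keeps the slope below
  \<open>c\<close>, and the new slope bounds \<open>rderiv U z\<close>.\<close>

lemma rderiv_right_limit:
  assumes U: "U \<in> G" and x: "0 \<le> x" "x < 1" and c: "rderiv U x < c"
  shows "\<exists>z. x < z \<and> z < 1 \<and> rderiv U z < c"
proof -
  obtain y where y: "x < y" "y \<le> 1" "(U y - U x) / (y - x) < c"
  proof -
    have "(INF y\<in>{x<..1}. (U y - U x) / (y - x)) < c" using c x by (simp add: rderiv_def)
    moreover have "bdd_below ((\<lambda>y. (U y - U x) / (y - x)) ` {x<..1})"
      by (rule bdd_belowI2[where m = 0]) (use slope_nonneg[OF U \<open>0 \<le> x\<close>] in auto)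
    ultimately obtain y where "y \<in> {x<..1}" "(U y - U x) / (y - x) < c"
      using x by (subst (asm) cINF_less_iff) auto
    with that show ?thesis by auto
  qed
  have "continuous_on {x..<y} (\<lambda>z. (U y - U z) / (y - z))"
    using x y by (intro continuous_intros continuous_on_subset[OF G_continuous[OF U]]) auto
  hence "((\<lambda>z. (U y - U z) / (y - z)) \<longlongrightarrow> (U y - U x) / (y - x)) (at x within {x..<y})"
    using y by (simp add: continuous_on_def)
  hence ev: "eventually (\<lambda>z. (U y - U z) / (y - z) < c) (at x within {x..<y})"
    using y(3) by (rule order_tendstoD)
  have "eventually (\<lambda>z. z \<in> {x<..<y}) (at_right x)"
    using y(1) by (rule eventually_at_right_real)
  moreover have "eventually (\<lambda>z. (U y - U z) / (y - z) < c) (at_right x)"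
  proof -
    have "at x within {x..<y} = at_right x"
      by (rule at_within_nhd[of _ "{..<y}"]) (use y in auto)
    thus ?thesis using ev by simp
  qed
  ultimately have "eventually (\<lambda>z. z \<in> {x<..<y} \<and> (U y - U z) / (y - z) < c) (at_right x)"
    by (rule eventually_conj)
  then obtain z where z: "x < z" "z < y" "(U y - U z) / (y - z) < c"
    using eventually_happens'[of "at_right x"] by auto
  have "rderiv U z \<le> (U y - U z) / (y - z)"
    using z y x by (intro rderiv_le_slope[OF U]) auto
  thus ?thesis using z y by (intro exI[of _ z]) auto
qed

lemma rderiv_eq_line:
  assumes U: "U \<in> G" and "s \<in> {0..1}" "t \<in> {0..1}" "rderiv U s = rderiv U t"
  shows "U t = U s + rderiv U s * (t - s)"
  using subgrad_onD[OF subgrad_rderiv[OF U] assms(2,3)] subgrad_onD[OF subgrad_rderiv[OF U] assms(3,2)]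
    assms(4) by (simp add: algebra_simps)

section \<open>Compactness and extreme maximizers\<close>

lemma G_seq_compact:
  assumes W: "\<And>n. W n \<in> G"
  obtains g k where "g \<in> G" "strict_mono (k :: nat \<Rightarrow> nat)"
    "\<And>x. x \<in> {0..1} \<Longrightarrow> (\<lambda>n. W (k n) x) \<longlonglongrightarrow> g x"
proof -
  \<comment> \<open>Slopes in \<open>[0, 2]\<close> make the class uniformly Lipschitz, so
    Arzela-Ascoli applies; the inequalities that define \<open>G\<close> are pointwise and pass to
    the limit.\<close>
  obtain g k where g: "continuous_on {0..1} g" "strict_mono (k :: nat \<Rightarrow> nat)"
    "\<And>e. 0 < e \<Longrightarrow> \<exists>N. \<forall>n x. n \<ge> N \<and> x \<in> {0..1} \<longrightarrow> norm (W (k n) x - g x) < e"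
  proof (rule Arzela_Ascoli[of "{0..1}" W 2])
    show "compact {0..1::real}" by simp
    show "norm (W n x) \<le> 2" if "x \<in> {0..1}" for n x
      using G_lipschitz[OF W[of n], of 0 x] GD(5)[OF W[of n]] that by auto
    show "\<exists>d>0. \<forall>n y. y \<in> {0..1} \<and> norm (x - y) < d \<longrightarrow> norm (W n x - W n y) < e"
      if "x \<in> {0..1}" "0 < e" for x e :: real
    proof (intro exI[of _ "e / 2"] conjI allI impI)
      fix n y assume y: "y \<in> {0..1} \<and> norm (x - y) < e / 2"
      thus "norm (W n x - W n y) < e"
        using G_lipschitz[OF W[of n], of y x] that by auto
    qed (use that in auto)
  qed auto
  have lim: "(\<lambda>n. W (k n) x) \<longlonglongrightarrow> g x" if "x \<in> {0..1}" for x
    unfolding LIMSEQ_iff using g(3) that by blast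
  have "g \<in> G" unfolding G_def
  proof (intro CollectI conjI ballI)
    show "convex_on {0..1} g"
    proof (rule convex_onI)
      fix t x y :: real assume t: "0 < t" "t < 1" and xy: "x \<in> {0..1}" "y \<in> {0..1}"
      have z: "(1 - t) *\<^sub>R x + t *\<^sub>R y \<in> {0..1}"
        using convexD[OF convex_closed_interval xy, of "1 - t" t] t by simp
      show "g ((1 - t) *\<^sub>R x + t *\<^sub>R y) \<le> (1 - t) * g x + t * g y"
      proof (rule LIMSEQ_le)
        show "(\<lambda>n. W (k n) ((1 - t) *\<^sub>R x + t *\<^sub>R y)) \<longlonglongrightarrow> g ((1 - t) *\<^sub>R x + t *\<^sub>R y)"
          by (rule lim[OF z])
        show "(\<lambda>n. (1 - t) * W (k n) x + t * W (k n) y) \<longlonglongrightarrow> (1 - t) * g x + t * g y"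
          by (intro tendsto_intros lim xy)
        show "\<exists>N. \<forall>n\<ge>N. W (k n) ((1 - t) *\<^sub>R x + t *\<^sub>R y) \<le> (1 - t) * W (k n) x + t * W (k n) y"
          using convex_onD[OF GD(1)[OF W]] t xy by auto
      qed
    qed simp
    fix v :: real assume v: "v \<in> {0..1}"
    show "0 \<le> g v" by (rule LIMSEQ_le_const[OF lim[OF v]]) (use GD(2)[OF W v] in auto)
    show "2 * v - 1 \<le> g v" by (rule LIMSEQ_le_const[OF lim[OF v]]) (use GD(3)[OF W v] in auto)
    show "g v \<le> V v" by (rule LIMSEQ_le_const2[OF lim[OF v]]) (use GD(4)[OF W v] in auto)
  qed
  with g(2) lim show ?thesis using that by blast
qed

text \<open>Extremality as the absence of two-sided perturbations. \<open>G\<close> constrains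
  values on \<open>[0, 1]\<close> only, so \<open>h\<close> has to vanish only there.\<close>

definition extremal :: "(real \<Rightarrow> real) \<Rightarrow> bool" where
  "extremal U \<longleftrightarrow> U \<in> G \<and>
     (\<forall>h. continuous_on {0..1} h \<and> (\<lambda>x. U x + h x) \<in> G \<and> (\<lambda>x. U x - h x) \<in> G \<longrightarrow> (\<forall>x\<in>{0..1}. h x = 0))"

text \<open>Among the maximizers of a linear functional, one that maximizes the strictly convex functional
  \<open>\<integral> U\<^sup>2\<close> is an extreme point; this replaces an appeal to the Krein-Milman theorem.\<close>
lemma extremal_maximizer_exists:
  fixes w :: "real \<Rightarrow> real" and \<alpha> \<beta> :: real
  assumes ab: "0 \<le> a" "a \<le> b" "b \<le> 1" and w: "continuous_on {a..b} w"
  defines "J \<equiv> \<lambda>W. \<alpha> * W b - \<beta> * W a + integral {a..b} (\<lambda>s. w s * W s)"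
  shows "\<exists>U. extremal U \<and> (\<forall>W\<in>G. J W \<le> J U)"
proof -
  obtain K where K: "\<And>s. s \<in> {a..b} \<Longrightarrow> \<bar>w s\<bar> \<le> K"
    using compact_imp_bounded[OF compact_continuous_image[OF w compact_Icc]]
    by (force simp: bounded_iff)
  have abs1: "\<bar>W x\<bar> \<le> 2" if "W \<in> G" "x \<in> {0..1}" for W x
    using G_lipschitz[OF that(1), of 0 x] GD(5)[OF that(1)] that by auto
  have cont: "continuous_on {a..b} W" if "W \<in> G" for W
    using ab by (intro continuous_on_subset[OF G_continuous[OF that]]) auto
  have intJ: "(\<lambda>s. w s * W s) integrable_on {a..b}" if "W \<in> G" for W
    by (intro integrable_continuous_interval continuous_intros w cont that)
  have limJ: "(\<lambda>n. J (W n)) \<longlonglongrightarrow> J g"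
    if W: "\<And>n. W n \<in> G" and lim: "\<And>x. x \<in> {0..1} \<Longrightarrow> (\<lambda>n. W n x) \<longlonglongrightarrow> g x" for W g
  proof -
    have "(\<lambda>n. integral {a..b} (\<lambda>s. w s * W n s)) \<longlonglongrightarrow> integral {a..b} (\<lambda>s. w s * g s)"
    proof (rule dominated_convergence(2)[where h = "\<lambda>_. K * 2"])
      fix n x assume x: "x \<in> {a..b}"
      thus "norm (w x * W n x) \<le> K * 2"
        using K[OF x] abs1[OF W, of x n] ab by (auto simp: abs_mult intro!: mult_mono')
    qed (use intJ[OF W] ab in \<open>auto intro!: tendsto_intros lim\<close>)
    thus ?thesis unfolding J_def using ab by (intro tendsto_intros lim) auto
  qed
  define Q where "Q W = integral {0..1} (\<lambda>s. (W s)\<^sup>2)" for W :: "real \<Rightarrow> real"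
  have intQ: "(\<lambda>s. (W s)\<^sup>2) integrable_on {0..1}" if "W \<in> G" for W
    by (intro integrable_continuous_interval continuous_intros G_continuous that)
  have limQ: "(\<lambda>n. Q (W n)) \<longlonglongrightarrow> Q g"
    if W: "\<And>n. W n \<in> G" and lim: "\<And>x. x \<in> {0..1} \<Longrightarrow> (\<lambda>n. W n x) \<longlonglongrightarrow> g x" for W g
    unfolding Q_def
  proof (rule dominated_convergence(2)[where h = "\<lambda>_. 2\<^sup>2"])
    fix n x assume x: "x \<in> {0..1::real}"
    thus "norm ((W n x)\<^sup>2) \<le> 2\<^sup>2"
      using power_mono[OF abs1[OF W x, of n], of 2] by simp
  qed (use intQ[OF W] in \<open>auto intro!: tendsto_intros lim\<close>)
  have "\<exists>U\<in>G. \<forall>W\<in>G. J W \<le> J U"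
  proof (rule attains_max_of_seq_compact)
    show "G \<noteq> {}" using V_in_G by auto
    fix W :: "nat \<Rightarrow> real \<Rightarrow> real" assume W: "\<And>n. W n \<in> G"
    obtain g k where "g \<in> G" "strict_mono (k :: nat \<Rightarrow> nat)"
      "\<And>x. x \<in> {0..1} \<Longrightarrow> (\<lambda>n. W (k n) x) \<longlonglongrightarrow> g x" using G_seq_compact[of W, OF W] by blast
    with limJ[of "\<lambda>n. W (k n)" g] W
    show "\<exists>g\<in>G. \<exists>k. strict_mono k \<and> (\<lambda>n. J (W (k n))) \<longlonglongrightarrow> J g" by blast
  qed
  then obtain U0 where U0: "U0 \<in> G" "\<And>W. W \<in> G \<Longrightarrow> J W \<le> J U0" by blast
  define C where "C = {W\<in>G. J W = J U0}"
  have "\<exists>U\<in>C. \<forall>W\<in>C. Q W \<le> Q U"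
  proof (rule attains_max_of_seq_compact)
    show "C \<noteq> {}" using U0 by (auto simp: C_def)
    fix W :: "nat \<Rightarrow> real \<Rightarrow> real" assume W: "\<And>n. W n \<in> C"
    hence WG: "W n \<in> G" for n by (simp add: C_def)
    obtain g k where gk: "g \<in> G" "strict_mono (k :: nat \<Rightarrow> nat)"
      "\<And>x. x \<in> {0..1} \<Longrightarrow> (\<lambda>n. W (k n) x) \<longlonglongrightarrow> g x" using G_seq_compact[of W, OF WG] by blast
    have "(\<lambda>n. J U0) \<longlonglongrightarrow> J g" using limJ[of "\<lambda>n. W (k n)" g, OF WG gk(3)] W by (simp add: C_def)
    hence "J U0 = J g" by (simp add: LIMSEQ_const_iff)
    hence "g \<in> C" using gk by (simp add: C_def)
    with limQ[of "\<lambda>n. W (k n)" g, OF WG gk(3)] gk(2)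
    show "\<exists>g\<in>C. \<exists>k. strict_mono k \<and> (\<lambda>n. Q (W (k n))) \<longlonglongrightarrow> Q g" by blast
  qed
  then obtain U where U: "U \<in> C" "\<And>W. W \<in> C \<Longrightarrow> Q W \<le> Q U" by blast
  have UG: "U \<in> G" and JU: "\<And>W. W \<in> G \<Longrightarrow> J W \<le> J U" using U U0 by (auto simp: C_def)
  have "h x = 0" if h: "continuous_on {0..1} h" "(\<lambda>x. U x + h x) \<in> G" "(\<lambda>x. U x - h x) \<in> G"
    and x: "x \<in> {0..1}" for h x
  proof -
    have ih: "(\<lambda>s. w s * h s) integrable_on {a..b}"
      using ab by (intro integrable_continuous_interval continuous_intros w continuous_on_subset[OF h(1)]) auto
    define c where "c = \<alpha> * h b - \<beta> * h a + integral {a..b} (\<lambda>s. w s * h s)"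
    have plus: "J (\<lambda>x. U x + h x) = J U + c"
      unfolding J_def c_def distrib_left
      by (subst Henstock_Kurzweil_Integration.integral_add[OF intJ[OF UG] ih]) (simp add: algebra_simps)
    have minus: "J (\<lambda>x. U x - h x) = J U - c"
      unfolding J_def c_def right_diff_distrib
      by (subst Henstock_Kurzweil_Integration.integral_diff[OF intJ[OF UG] ih]) (simp add: algebra_simps)
    \<comment> \<open>\<open>U + h\<close> and \<open>U - h\<close> both compete, so the linear part
      \<open>c\<close> vanishes and both are maximizers as well.\<close>
    have "c = 0" using JU[OF h(2)] JU[OF h(3)] plus minus by simp
    hence "Q (\<lambda>x. U x + h x) \<le> Q U" "Q (\<lambda>x. U x - h x) \<le> Q U"
      using U plus minus h by (auto simp: C_def)
    \<comment> \<open>Parallelogram law: one of the two values of \<open>Q\<close> is at least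
      \<open>Q U + Q h\<close>, so maximality of \<open>Q U\<close> leaves
      \<open>Q h \<le> 0\<close>.\<close>
    moreover have "Q (\<lambda>x. U x + h x) + Q (\<lambda>x. U x - h x) = 2 * Q U + 2 * Q h"
    proof -
      have ih2: "(\<lambda>s. (h s)\<^sup>2) integrable_on {0..1}"
        by (intro integrable_continuous_interval continuous_intros h)
      have "Q (\<lambda>x. U x + h x) + Q (\<lambda>x. U x - h x) =
          integral {0..1} (\<lambda>s. (U s + h s)\<^sup>2 + (U s - h s)\<^sup>2)"
        unfolding Q_def using intQ[OF h(2)] intQ[OF h(3)]
        by (subst Henstock_Kurzweil_Integration.integral_add) auto
      also have "\<dots> = integral {0..1} (\<lambda>s. 2 * (U s)\<^sup>2 + 2 * (h s)\<^sup>2)"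
        by (simp add: power2_eq_square algebra_simps)
      also have "\<dots> = 2 * Q U + 2 * Q h"
        unfolding Q_def using intQ[OF UG] ih2
        by (subst Henstock_Kurzweil_Integration.integral_add) (auto simp: integrable_on_cmult_left)
      finally show ?thesis .
    qed
    ultimately have "Q h \<le> 0" by simp
    moreover have "Q h \<ge> 0" unfolding Q_def by (rule Henstock_Kurzweil_Integration.integral_nonneg)
      (auto intro!: integrable_continuous_interval continuous_intros h)
    ultimately have "Q h = 0" by simp
    hence "((\<lambda>s. (h s)\<^sup>2) has_integral 0) (cbox 0 1)"
      unfolding Q_def by (metis cbox_interval h(1) continuous_on_power integrable_continuous_interval integrable_integral)
    moreover have "continuous_on (cbox 0 1) (\<lambda>s. (h s)\<^sup>2)"
      using h(1) by (auto intro!: continuous_intros)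
    ultimately have "(h x)\<^sup>2 = 0"
      by (intro has_integral_0_cbox_imp_0[where f = "\<lambda>s. (h s)\<^sup>2" and a = 0 and b = 1]) (use x in auto)
    thus ?thesis by simp
  qed
  hence "extremal U" using UG by (auto simp: extremal_def)
  with JU show ?thesis by blast
qed

end

section \<open>Extreme points\<close>

context screening begin

text \<open>If \<open>m\<close> is nondecreasing and \<open>\<Phi>\<close> is 1-Lipschitz then \<open>m \<plusminus> \<Phi> \<circ> m\<close> is nondecreasing too, so adding
  a small multiple of \<open>\<integral> \<Phi> \<circ> m\<close> to \<open>U\<close> or subtracting it keeps convexity.\<close>
lemma extremal_perturbation:
  assumes ex: "extremal U" and x01: "0 \<le> x0" "x0 < x1" "x1 \<le> 1"
    and gap: "\<And>x. x \<in> {x0..x1} \<Longrightarrow> U x < V x"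
    and lip: "\<And>c d. \<bar>\<Phi> c - \<Phi> d\<bar> \<le> \<bar>c - d\<bar>"
    and supp: "\<And>c. c \<le> rderiv U x0 \<or> rderiv U x1 \<le> c \<Longrightarrow> \<Phi> c = 0"
    and zero: "integral {0..1} (\<lambda>x. \<Phi> (rderiv U x)) = 0"
    and x: "x \<in> {0..1}"
  shows "integral {0..x} (\<lambda>x. \<Phi> (rderiv U x)) = 0"
proof -
  define m where "m = rderiv U"
  have UG: "U \<in> G" using ex by (simp add: extremal_def)
  have mono: "mono_on {0..1} m" unfolding m_def by (rule rderiv_mono[OF UG])
  have mono': "mono_on {0..1} (\<lambda>x. m x + e * \<Phi> (m x))" if "\<bar>e\<bar> \<le> 1" for e
  proof (rule mono_onI)
    fix s t :: real assume "s \<in> {0..1}" "t \<in> {0..1}" "s \<le> t"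
    hence "m s \<le> m t" using mono_onD[OF mono] by simp
    have "\<bar>e * (\<Phi> (m s) - \<Phi> (m t))\<bar> \<le> 1 * \<bar>m s - m t\<bar>"
      unfolding abs_mult using that lip by (intro mult_mono) auto
    with \<open>m s \<le> m t\<close> show "m s + e * \<Phi> (m s) \<le> m t + e * \<Phi> (m t)" by (simp add: algebra_simps)
  qed
  have intm: "m integrable_on {s..t}" if "0 \<le> s" "t \<le> 1" for s t
    using that by (intro integrable_on_mono_on monotone_on_subset[OF mono]) auto
  have int\<Phi>: "(\<lambda>x. \<Phi> (m x)) integrable_on {s..t}" if "0 \<le> s" "t \<le> 1" for s t
  proof -
    have "(\<lambda>x. m x + 1 * \<Phi> (m x)) integrable_on {s..t}"
      using that by (intro integrable_on_mono_on monotone_on_subset[OF mono'[of 1]]) auto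
    from integrable_diff[OF this intm[OF that]] show ?thesis by simp
  qed
  \<comment> \<open>\<open>h\<close> vanishes up to \<open>x0\<close> because \<open>\<Phi>\<close>
    is zero at the slopes found there, and from \<open>x1\<close> on because the total integral is
    zero; so it acts only where \<open>U < V\<close>.\<close>
  define h where "h x = integral {0..x} (\<lambda>x. \<Phi> (m x))" for x
  have conth: "continuous_on {0..1} h"
    unfolding h_def by (rule indefinite_integral_continuous_1[OF int\<Phi>]) auto
  have \<Phi>0: "\<Phi> (m x) = 0" if "x \<in> {0..x0} \<union> {x1..1}" for x
    using that x01 mono_onD[OF mono, of x x0] mono_onD[OF mono, of x1 x]
    by (intro supp) (auto simp: m_def)
  have h0: "h x = 0" if "x \<in> {0..x0}" for x
    unfolding h_def using that \<Phi>0 by (intro integral_unique has_integral_is_0) auto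
  have h1: "h x = 0" if "x \<in> {x1..1}" for x
  proof -
    have "integral {0..x} (\<lambda>x. \<Phi> (m x)) + integral {x..1} (\<lambda>x. \<Phi> (m x)) = integral {0..1} (\<lambda>x. \<Phi> (m x))"
      using that x01 by (intro Henstock_Kurzweil_Integration.integral_combine int\<Phi>) auto
    moreover have "integral {x..1} (\<lambda>x. \<Phi> (m x)) = 0"
      using that \<Phi>0 by (intro integral_unique has_integral_is_0) auto
    ultimately show ?thesis using zero by (simp add: h_def m_def)
  qed
  obtain \<eta> where \<eta>: "\<eta> > 0" "\<And>x. x \<in> {x0..x1} \<Longrightarrow> U x + \<eta> \<le> V x"
  proof -
    have "continuous_on {x0..x1} (\<lambda>x. V x - U x)"
      using x01 by (intro continuous_intros continuous_on_subset[OF contV] continuous_on_subset[OF G_continuous[OF UG]]) auto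
    from continuous_attains_inf[OF compact_Icc _ this] x01 obtain z
      where z: "z \<in> {x0..x1}" "\<And>x. x \<in> {x0..x1} \<Longrightarrow> V z - U z \<le> V x - U x" by fastforce
    show ?thesis
    proof (rule that[of "V z - U z"])
      show "V z - U z > 0" using gap[OF z(1)] by simp
      show "U x + (V z - U z) \<le> V x" if "x \<in> {x0..x1}" for x using z(2)[OF that] by simp
    qed
  qed
  obtain K where K: "\<And>s. s \<in> {0..1} \<Longrightarrow> \<bar>h s\<bar> \<le> K"
    using compact_imp_bounded[OF compact_continuous_image[OF conth compact_Icc]]
    by (force simp: bounded_iff)
  have "K \<ge> 0" using K[of 0] by fastforce
  \<comment> \<open>The bound 1 keeps the perturbed slope monotone, and
    \<open>\<eta> / (K + 1)\<close> keeps the perturbed utility below \<open>V\<close>; adding 1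
    covers \<open>K = 0\<close>.\<close>
  define \<epsilon> where "\<epsilon> = min 1 (\<eta> / (K + 1))"
  have \<epsilon>: "\<epsilon> > 0" "\<epsilon> \<le> 1" using \<eta> \<open>K \<ge> 0\<close> by (auto simp: \<epsilon>_def)
  have \<epsilon>h: "\<bar>\<epsilon> * h s\<bar> \<le> \<eta>" if "s \<in> {0..1}" for s
  proof -
    have "\<bar>\<epsilon> * h s\<bar> \<le> (\<eta> / (K + 1)) * (K + 1)"
      unfolding abs_mult using K[OF that] \<epsilon> \<eta> \<open>K \<ge> 0\<close> by (intro mult_mono) (auto simp: \<epsilon>_def)
    thus ?thesis using \<open>K \<ge> 0\<close> by simp
  qed
  have inG: "(\<lambda>x. U x + e * h x) \<in> G" if e: "\<bar>e\<bar> = \<epsilon>" for e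
  proof -
    define W where "W x = U x + e * h x" for x
    define M where "M x = m x + e * \<Phi> (m x)" for x
    have e1: "\<bar>e\<bar> \<le> 1" using e \<epsilon> by simp
    have "subgrad_on {0..1} (\<lambda>x. 0 + integral {0..x} M) M"
      unfolding M_def by (rule indefinite_integral_subgrad_on[OF mono'[OF e1]])
    moreover have "0 + integral {0..x} M = W x" if "x \<in> {0..1}" for x
    proof -
      have "(m has_integral (U x - U 0)) {0..x}"
        unfolding m_def using that
        by (intro subgrad_on_has_integral subgrad_on_subset[OF subgrad_rderiv[OF UG]]) auto
      moreover have "((\<lambda>x. \<Phi> (m x)) has_integral h x) {0..x}"
        unfolding h_def using int\<Phi>[of 0 x] that by (intro integrable_integral) auto
      ultimately have "(M has_integral (U x - U 0) + e * h x) {0..x}"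
        unfolding M_def by (intro has_integral_add has_integral_mult_right)
      thus ?thesis using GD(5)[OF UG] by (simp add: W_def integral_unique)
    qed
    ultimately have sg: "subgrad_on {0..1} W M"
      by (simp add: subgrad_on_def)
    have W01: "W 0 = 0" "W 1 = 1"
      using h0[of 0] h1[of 1] x01 GD(5,6)[OF UG] by (auto simp: W_def)
    \<comment> \<open>The slopes at 0 and 1 are unchanged, so the supporting lines at the two ends
      still give the lower bounds 0 and \<open>2 * v - 1\<close>.\<close>
    have M01: "M 0 \<ge> 0" "M 1 = 2"
      using \<Phi>0[of 0] \<Phi>0[of 1] rderiv_bounds[OF UG, of 0] x01 by (auto simp: M_def m_def rderiv_def[of U 1])
    have "W \<in> G" unfolding G_def
    proof (intro CollectI conjI ballI)
      show "convex_on {0..1} W" by (rule subgrad_on_imp_convex_on[OF sg]) simp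
      fix v :: real assume v: "v \<in> {0..1}"
      show "0 \<le> W v" using subgrad_onD[OF sg, of 0 v] v M01 W01
        by (smt (verit, best) atLeastAtMost_iff mult_nonneg_nonneg)
      show "2 * v - 1 \<le> W v" using subgrad_onD[OF sg, of 1 v] v M01 W01 by simp
      show "W v \<le> V v"
      proof (cases "v \<in> {x0..x1}")
        case True
        have "\<bar>e * h v\<bar> \<le> \<eta>" using \<epsilon>h[OF v] e by (simp add: abs_mult \<epsilon>(1))
        thus ?thesis using \<eta>(2)[OF True] by (auto simp: W_def)
      next
        case False
        hence "h v = 0" using v h0[of v] h1[of v] by auto
        thus ?thesis using GD(4)[OF UG v] by (simp add: W_def)
      qed
    qed
    thus ?thesis by (simp add: W_def[abs_def])
  qed
  have "continuous_on {0..1} (\<lambda>x. \<epsilon> * h x)" by (intro continuous_intros conth)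
  with ex inG[of \<epsilon>] inG[of "- \<epsilon>"] \<epsilon> x have "\<epsilon> * h x = 0"
    unfolding extremal_def by auto
  thus ?thesis using \<epsilon> by (simp add: h_def m_def)
qed

text \<open>For \<open>l \<le> u\<close> the inner maximum is the distance from \<open>c\<close> to
  \<open>[l, u]\<close>, so this is a trapezoid of height \<open>\<delta>\<close> with sides of
  slope 1 and -1: 1-Lipschitz, as \<open>extremal_perturbation\<close> requires.\<close>

definition tent :: "real \<Rightarrow> real \<Rightarrow> real \<Rightarrow> real \<Rightarrow> real" where
  "tent l u \<delta> c = max 0 (\<delta> - max 0 (max (l - c) (c - u)))"

lemma tent_lipschitz: "\<bar>tent l u \<delta> c - tent l u \<delta> d\<bar> \<le> \<bar>c - d\<bar>"
  unfolding tent_def by linarith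

text \<open>Raise the slopes in the first band and lower those in the second, in proportions that
  cancel in the integral: the perturbation is admissible, yet it moves \<open>U\<close> on the first
  interval. A tent on one band alone has positive integral and would not return to zero.\<close>

lemma extremal_no_two_pieces:
  assumes ex: "extremal U" and x01: "0 \<le> x0" "x0 < x1" "x1 \<le> 1"
    and gap: "\<And>x. x \<in> {x0..x1} \<Longrightarrow> U x < V x"
    and lu: "rderiv U x0 < la" "la \<le> ua" "ua < lb" "lb \<le> ub" "ub < rderiv U x1"
    and I1: "0 \<le> pa" "pa < qa" "qa \<le> 1" "\<And>x. x \<in> {pa<..<qa} \<Longrightarrow> rderiv U x \<in> {la..ua}"
    and I2: "0 \<le> pb" "pb < qb" "qb \<le> 1" "\<And>x. x \<in> {pb<..<qb} \<Longrightarrow> rderiv U x \<in> {lb..ub}"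
  shows False
proof -
  define m where "m = rderiv U"
  have UG: "U \<in> G" using ex by (simp add: extremal_def)
  have mono: "mono_on {0..1} m" unfolding m_def by (rule rderiv_mono[OF UG])
  \<comment> \<open>Tents of height \<open>\<delta> / 2\<close> are nonzero on disjoint sets of
    slopes and vanish at the slopes of \<open>x0\<close> and \<open>x1\<close>.\<close>
  define \<delta> where "\<delta> = min (la - m x0) (min (lb - ua) (m x1 - ub))"
  have \<delta>: "\<delta> > 0" "\<delta> \<le> la - m x0" "\<delta> \<le> lb - ua" "\<delta> \<le> m x1 - ub" using lu by (auto simp: \<delta>_def m_def)
  define T1 where "T1 = tent la ua (\<delta>/2)"
  define T2 where "T2 = tent lb ub (\<delta>/2)"
  have intm: "m integrable_on {s..t}" if "0 \<le> s" "t \<le> 1" for s t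
    using that by (intro integrable_on_mono_on monotone_on_subset[OF mono]) auto
  have intT: "(\<lambda>x. tent l u d (m x)) integrable_on {s..t}" if st: "0 \<le> s" "t \<le> 1" for l u d s t
  proof -
    have mt: "mono_on {0..1} (\<lambda>x. m x + tent l u d (m x))"
    proof (rule mono_onI)
      fix s t :: real assume "s \<in> {0..1}" "t \<in> {0..1}" "s \<le> t"
      hence "m s \<le> m t" using mono_onD[OF mono] by simp
      with tent_lipschitz[of l u d "m s" "m t"]
      show "m s + tent l u d (m s) \<le> m t + tent l u d (m t)" by linarith
    qed
    hence "(\<lambda>x. m x + tent l u d (m x)) integrable_on {s..t}"
      using st by (intro integrable_on_mono_on monotone_on_subset[OF mt]) auto
    from integrable_diff[OF this intm[OF st]] show ?thesis by simp
  qed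
  have pos: "integral {0..1} (\<lambda>x. tent l u (\<delta>/2) (m x)) > 0"
    if "0 \<le> \<alpha>" "\<alpha> < \<beta>" "\<beta> \<le> 1" "\<And>x. x \<in> {\<alpha><..<\<beta>} \<Longrightarrow> m x \<in> {l..u}" for \<alpha> \<beta> l u
  proof -
    \<comment> \<open>The slopes are controlled on the open interval only, hence the closed middle
      third.\<close>
    define \<alpha>' \<beta>' where "\<alpha>' = (2 * \<alpha> + \<beta>) / 3" and "\<beta>' = (\<alpha> + 2 * \<beta>) / 3"
    have ab: "\<alpha> < \<alpha>'" "\<alpha>' < \<beta>'" "\<beta>' < \<beta>" using that by (auto simp: \<alpha>'_def \<beta>'_def)
    have "0 < \<delta> / 2 * (\<beta>' - \<alpha>')" using ab \<delta> by simp
    also have "\<dots> = integral {\<alpha>'..\<beta>'} (\<lambda>_. \<delta> / 2)" using ab by simp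
    also have "\<dots> \<le> integral {\<alpha>'..\<beta>'} (\<lambda>x. tent l u (\<delta>/2) (m x))"
    proof (rule integral_le)
      fix x assume "x \<in> {\<alpha>'..\<beta>'}"
      hence "m x \<in> {l..u}" using that(4)[of x] ab by auto
      thus "\<delta> / 2 \<le> tent l u (\<delta>/2) (m x)" by (auto simp: tent_def)
    qed (use ab that intT in auto)
    also have "\<dots> \<le> integral {0..1} (\<lambda>x. tent l u (\<delta>/2) (m x))"
      using ab that by (intro integral_subset_le intT) (auto simp: tent_def)
    finally show ?thesis .
  qed
  define i1 where "i1 = integral {0..1} (\<lambda>x. T1 (m x))"
  define i2 where "i2 = integral {0..1} (\<lambda>x. T2 (m x))"
  have i1: "i1 > 0" unfolding i1_def T1_def using I1 by (intro pos) (auto simp: m_def)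
  have i2: "i2 > 0" unfolding i2_def T2_def using I2 by (intro pos) (auto simp: m_def)
  \<comment> \<open>Chosen so that \<open>a * i1 = (1 - a) * i2\<close>; as \<open>a\<close> lies
    between 0 and 1, \<open>\<Phi>\<close> is still 1-Lipschitz.\<close>
  define a where "a = i2 / (i1 + i2)"
  have a: "0 < a" "a < 1" "1 - a = i1 / (i1 + i2)" using i1 i2 by (auto simp: a_def field_simps)
  define \<Phi> where "\<Phi> c = a * T1 c - (1 - a) * T2 c" for c
  have tent_in: "tent l u d c = d" if "c \<in> {l..u}" "d \<ge> 0" for l u d c
    using that by (simp add: tent_def)
  have tent_out: "tent l u d c = 0" if "c \<le> l - d \<or> u + d \<le> c" for l u d c
    using that unfolding tent_def by linarith
  have \<Phi>pos: "\<Phi> c = a * (\<delta> / 2)" if "c \<in> {la..ua}" for c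
  proof -
    have "T1 c = \<delta> / 2" unfolding T1_def by (rule tent_in) (use that \<delta> in auto)
    moreover have "T2 c = 0" unfolding T2_def by (rule tent_out) (use that \<delta> in auto)
    ultimately show ?thesis by (simp add: \<Phi>_def)
  qed
  have int\<Phi>: "(\<lambda>x. \<Phi> (m x)) integrable_on {s..t}" if "0 \<le> s" "t \<le> 1" for s t
    unfolding \<Phi>_def T1_def T2_def using that by (intro integrable_diff integrable_on_mult_right intT)
  have h0: "integral {0..x} (\<lambda>x. \<Phi> (m x)) = 0" if "x \<in> {0..1}" for x
    unfolding m_def
  proof (rule extremal_perturbation[OF ex x01 gap _ _ _ that])
    fix c d
    have "\<bar>\<Phi> c - \<Phi> d\<bar> = \<bar>a * (T1 c - T1 d) + (1 - a) * (T2 d - T2 c)\<bar>" by (simp add: \<Phi>_def algebra_simps)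
    also have "\<dots> \<le> a * \<bar>T1 c - T1 d\<bar> + (1 - a) * \<bar>T2 d - T2 c\<bar>"
      using a(1,2) by (intro order_trans[OF abs_triangle_ineq]) (simp add: abs_mult)
    also have "\<dots> \<le> a * \<bar>c - d\<bar> + (1 - a) * \<bar>d - c\<bar>"
      unfolding T1_def T2_def using a(1,2) by (intro add_mono mult_left_mono tent_lipschitz) auto
    also have "\<dots> = \<bar>c - d\<bar>" by (simp add: abs_minus_commute algebra_simps)
    finally show "\<bar>\<Phi> c - \<Phi> d\<bar> \<le> \<bar>c - d\<bar>" .
  next
    fix c assume "c \<le> rderiv U x0 \<or> rderiv U x1 \<le> c"
    hence "c \<le> m x0 \<or> m x1 \<le> c" by (simp add: m_def)
    hence "T1 c = 0" "T2 c = 0"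
      unfolding T1_def T2_def using \<delta> lu by (intro tent_out; auto)+
    thus "\<Phi> c = 0" by (simp add: \<Phi>_def)
  next
    have "integral {0..1} (\<lambda>x. \<Phi> (m x)) = a * i1 - (1 - a) * i2"
      unfolding \<Phi>_def i1_def i2_def
      by (subst Henstock_Kurzweil_Integration.integral_diff)
         (auto intro!: integrable_on_mult_right intT simp: T1_def T2_def)
    also have "\<dots> = 0" using i1 i2 by (simp add: a(3)) (simp add: a_def)
    finally show "integral {0..1} (\<lambda>x. \<Phi> (rderiv U x)) = 0" by (simp add: m_def)
  qed auto
  \<comment> \<open>On the middle third of the first interval \<open>\<Phi>\<close> has the constant
    value \<open>a * (\<delta> / 2)\<close>, so its indefinite integral cannot vanish at both ends
    of it.\<close>
  define \<alpha>' \<beta>' where "\<alpha>' = (2 * pa + qa) / 3" and "\<beta>' = (pa + 2 * qa) / 3"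
  have ab: "pa < \<alpha>'" "\<alpha>' < \<beta>'" "\<beta>' < qa" using I1 by (auto simp: \<alpha>'_def \<beta>'_def)
  have "integral {0..\<alpha>'} (\<lambda>x. \<Phi> (m x)) + integral {\<alpha>'..\<beta>'} (\<lambda>x. \<Phi> (m x)) = integral {0..\<beta>'} (\<lambda>x. \<Phi> (m x))"
    using ab I1 by (intro Henstock_Kurzweil_Integration.integral_combine int\<Phi>) auto
  moreover have "integral {\<alpha>'..\<beta>'} (\<lambda>x. \<Phi> (m x)) = integral {\<alpha>'..\<beta>'} (\<lambda>x. a * (\<delta> / 2))"
  proof (rule Henstock_Kurzweil_Integration.integral_cong)
    fix x assume "x \<in> {\<alpha>'..\<beta>'}"
    thus "\<Phi> (m x) = a * (\<delta> / 2)" using ab I1(4)[of x] by (intro \<Phi>pos) (auto simp: m_def)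
  qed
  ultimately have "a * (\<delta> / 2) * (\<beta>' - \<alpha>') = 0"
    using h0[of \<alpha>'] h0[of \<beta>'] ab I1 by simp
  thus False using a \<delta> ab by simp
qed

text \<open>If the slope grew immediately after \<open>s\<close>, right continuity would produce
  arbitrarily many slopes descending to \<open>rderiv U s\<close> within a region where
  \<open>U < V\<close>; four of them bound two disjoint bands.\<close>

lemma extremal_right_affine:
  assumes ex: "extremal U" and s: "0 < s" "s < 1" and lt: "U s < V s"
  shows "\<exists>t. s < t \<and> t \<le> 1 \<and> rderiv U t = rderiv U s"
proof (rule ccontr)
  assume neg: "\<not> ?thesis"
  have UG: "U \<in> G" using ex by (simp add: extremal_def)
  have mono: "mono_on {0..1} (rderiv U)" by (rule rderiv_mono[OF UG])
  have gt: "rderiv U s < rderiv U t" if "s < t" "t \<le> 1" for t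
    using neg that mono_onD[OF mono, of s t] s by force
  have step: "\<exists>t'. s < t' \<and> t' < t \<and> rderiv U t' < rderiv U t" if "s < t" "t \<le> 1" for t
  proof -
    from rderiv_right_limit[OF UG _ s(2) gt[OF that]] s obtain z
      where "s < z" "z < 1" "rderiv U z < rderiv U t" by auto
    moreover from this that mono_onD[OF mono, of t z] s have "z < t" by (force simp: not_less)
    ultimately show ?thesis by blast
  qed
  obtain x1 where x1: "s < x1" "x1 \<le> 1" "\<And>x. x \<in> {s..x1} \<Longrightarrow> U x < V x"
  proof -
    have "continuous_on {0..1} (\<lambda>x. V x - U x)"
      by (intro continuous_intros contV G_continuous UG)
    hence "isCont (\<lambda>x. V x - U x) s"
      using s by (intro continuous_on_interior) (auto simp: interior_atLeastAtMost_real)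
    hence "eventually (\<lambda>x. 0 < V x - U x) (at s)"
      using lt by (intro order_tendstoD) (auto simp: isCont_def)
    then obtain d where d: "d > 0" "\<And>x. x \<noteq> s \<Longrightarrow> dist x s < d \<Longrightarrow> 0 < V x - U x"
      unfolding eventually_at by auto
    show ?thesis
    proof (rule that[of "min 1 (s + d / 2)"])
      fix x assume "x \<in> {s..min 1 (s + d / 2)}"
      thus "U x < V x" using d lt by (cases "x = s") (auto simp: dist_real_def)
    qed (use d s in auto)
  qed
  obtain t1 where t1: "s < t1" "t1 < x1" "rderiv U t1 < rderiv U x1" using step[of x1] x1 by auto
  obtain t2 where t2: "s < t2" "t2 < t1" "rderiv U t2 < rderiv U t1" using step[of t1] t1 x1 by auto
  obtain t3 where t3: "s < t3" "t3 < t2" "rderiv U t3 < rderiv U t2" using step[of t2] t1 t2 x1 by auto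
  obtain t4 where t4: "s < t4" "t4 < t3" "rderiv U t4 < rderiv U t3" using step[of t3] t1 t2 t3 x1 by auto
  show False
  proof (rule extremal_no_two_pieces[OF ex _ x1(1,2,3),
        where la = "rderiv U t4" and ua = "rderiv U t3" and lb = "rderiv U t2" and ub = "rderiv U t1"
        and pa = t4 and qa = t3 and pb = t2 and qb = t1])
    show "rderiv U x \<in> {rderiv U t4..rderiv U t3}" if "x \<in> {t4<..<t3}" for x
      using that t1 t2 t3 t4 x1 s by (auto intro!: mono_onD[OF mono])
    show "rderiv U x \<in> {rderiv U t2..rderiv U t1}" if "x \<in> {t2<..<t1}" for x
      using that t1 t2 t3 t4 x1 s by (auto intro!: mono_onD[OF mono])
    show "rderiv U s < rderiv U t4" using gt t1 t2 t3 t4 x1 by auto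
  qed (use t1 t2 t3 t4 x1 s in auto)
qed

definition tangent :: "(real \<Rightarrow> real) \<Rightarrow> real \<Rightarrow> real \<Rightarrow> real" where
  "tangent U s v = U s + rderiv U s * (v - s)"

text \<open>Neither line meets \<open>V\<close> anywhere, so on the way outwards from the two pieces
  the slope has to change before \<open>U\<close> can meet \<open>V\<close>. This yields
  \<open>x0\<close> with a smaller and \<open>x1\<close> with a larger slope and
  \<open>U < V\<close> in between; the two given slopes are then degenerate bands for
  \<open>extremal_no_two_pieces\<close>.\<close>

lemma extremal_adjacent_pieces:
  assumes ex: "extremal U" and uu': "0 \<le> u" "u < u'" "u' \<le> 1"
    and lt: "rderiv U u < rderiv U u'"
    and two: "\<And>x. x \<in> {u..u'} \<Longrightarrow> rderiv U x = rderiv U u \<or> rderiv U x = rderiv U u'"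
    and nt: "\<And>v. v \<in> {0..1} \<Longrightarrow> tangent U u v < V v"
    and nt': "\<And>v. v \<in> {0..1} \<Longrightarrow> tangent U u' v < V v"
  shows False
proof -
  have UG: "U \<in> G" using ex by (simp add: extremal_def)
  have mono: "mono_on {0..1} (rderiv U)" by (rule rderiv_mono[OF UG])
  have ueq: "U x = tangent U u x" if "x \<in> {0..1}" "rderiv U x = rderiv U u" for x
    using rderiv_eq_line[OF UG, of u x] that uu' by (simp add: tangent_def)
  have ueq': "U x = tangent U u' x" if "x \<in> {0..1}" "rderiv U x = rderiv U u'" for x
    using rderiv_eq_line[OF UG, of u' x] that uu' by (simp add: tangent_def)
  have Uu: "U u < V u" using nt[of u] uu' by (simp add: tangent_def)
  have Uu': "U u' < V u'" using nt'[of u'] uu' by (simp add: tangent_def)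
  have "u \<noteq> 0" using Uu GD(5)[OF UG] V_ends by auto
  hence u0: "0 < u" using uu' by simp
  have "u' \<noteq> 1" using Uu' GD(6)[OF UG] V_ends by auto
  hence ua: "u' < 1" using uu' by simp
  have contUV: "continuous_on {0..1} (\<lambda>x. V x - U x)"
    by (intro continuous_intros contV G_continuous UG)
  have contUt: "continuous_on {0..1} (\<lambda>x. U x - tangent U s x)" for s
    unfolding tangent_def by (intro continuous_intros G_continuous UG)
  have cl: "closed {x \<in> S. V x - U x = 0}" if "S \<subseteq> {0..1}" "closed S" for S
    using that by (intro continuous_closed_preimage_constant continuous_on_subset[OF contUV])
  obtain t where t: "u < t" "t \<le> 1" "rderiv U t = rderiv U u"
    using extremal_right_affine[OF ex u0 _ Uu] uu' by auto
  obtain t' where t': "u' < t'" "t' \<le> 1" "rderiv U t' = rderiv U u'"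
    using extremal_right_affine[OF ex _ ua Uu'] uu' by auto
  obtain x0 where x0: "0 \<le> x0" "x0 < u" "rderiv U x0 < rderiv U u" "\<And>x. x \<in> {x0..u} \<Longrightarrow> U x < V x"
  proof -
    \<comment> \<open>The contact points to the left of \<open>u\<close>; 0 is one. If the slope
      were constant from the last of them up to \<open>u\<close>, the line of \<open>u\<close> would
      touch \<open>V\<close> there.\<close>
    define Z where "Z = {x \<in> {0..u}. V x - U x = 0}"
    have "bounded Z" by (rule bounded_subset[of "{0..u}"]) (auto simp: Z_def)
    moreover have "closed Z" unfolding Z_def by (rule cl) (use uu' in auto)
    moreover have "0 \<in> Z" using uu' GD(5)[OF UG] V_ends by (auto simp: Z_def)
    ultimately obtain z where z: "z \<in> Z" "\<And>x. x \<in> Z \<Longrightarrow> x \<le> z"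
      using compact_attains_sup[of Z] by (auto simp: compact_eq_bounded_closed)
    have zu: "z < u" using z(1) Uu by (cases "z = u") (auto simp: Z_def)
    have z0: "0 \<le> z" using z by (auto simp: Z_def)
    have ltV: "U x < V x" if "z < x" "x \<le> u" for x
      using z(2)[of x] that z0 GD(4)[OF UG, of x] uu' by (force simp: Z_def)
    have "\<exists>x0\<in>{z<..<u}. rderiv U x0 \<noteq> rderiv U u"
    proof (rule ccontr)
      assume neg: "\<not> ?thesis"
      have "U z - tangent U u z = 0"
      proof (rule continuous_constant_on_closure[where f = "\<lambda>x. U x - tangent U u x" and S = "{z<..<u}" and x = z])
        show "continuous_on (closure {z<..<u}) (\<lambda>x. U x - tangent U u x)"
          using zu z0 uu' by (intro continuous_on_subset[OF contUt]) auto
        show "U x - tangent U u x = 0" if "x \<in> {z<..<u}" for x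
          using neg that ueq[of x] z0 uu' by auto
      qed (use zu in auto)
      with nt[of z] z zu z0 uu' show False by (auto simp: Z_def)
    qed
    then obtain x0 where x0: "x0 \<in> {z<..<u}" "rderiv U x0 \<noteq> rderiv U u" by blast
    show ?thesis
    proof (rule that[of x0])
      show "rderiv U x0 < rderiv U u" using x0 mono_onD[OF mono, of x0 u] z0 uu' by force
    qed (use x0 z0 ltV in auto)
  qed
  obtain x1 where x1: "u' < x1" "x1 \<le> 1" "rderiv U u' < rderiv U x1" "\<And>x. x \<in> {u'..x1} \<Longrightarrow> U x < V x"
  proof -
    define Z where "Z = {x \<in> {u'..1}. V x - U x = 0}"
    have "bounded Z" by (rule bounded_subset[of "{u'..1}"]) (auto simp: Z_def)
    moreover have "closed Z" unfolding Z_def by (rule cl) (use uu' in auto)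
    moreover have "1 \<in> Z" using uu' GD(6)[OF UG] V_ends by (auto simp: Z_def)
    ultimately obtain z where z: "z \<in> Z" "\<And>x. x \<in> Z \<Longrightarrow> z \<le> x"
      using compact_attains_inf[of Z] by (auto simp: compact_eq_bounded_closed)
    have zu: "u' < z" using z(1) Uu' by (cases "z = u'") (auto simp: Z_def)
    have z0: "z \<le> 1" using z by (auto simp: Z_def)
    have ltV: "U x < V x" if "x < z" "u' \<le> x" for x
      using z(2)[of x] that z0 GD(4)[OF UG, of x] uu' by (force simp: Z_def)
    have "\<exists>x1\<in>{u'<..<z}. rderiv U x1 \<noteq> rderiv U u'"
    proof (rule ccontr)
      assume neg: "\<not> ?thesis"
      have "U z - tangent U u' z = 0"
      proof (rule continuous_constant_on_closure[where f = "\<lambda>x. U x - tangent U u' x" and S = "{u'<..<z}" and x = z])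
        show "continuous_on (closure {u'<..<z}) (\<lambda>x. U x - tangent U u' x)"
          using zu z0 uu' by (intro continuous_on_subset[OF contUt]) auto
        show "U x - tangent U u' x = 0" if "x \<in> {u'<..<z}" for x
          using neg that ueq'[of x] z0 uu' by auto
      qed (use zu in auto)
      with nt'[of z] z zu z0 uu' show False by (auto simp: Z_def)
    qed
    then obtain x1 where x1: "x1 \<in> {u'<..<z}" "rderiv U x1 \<noteq> rderiv U u'" by blast
    show ?thesis
    proof (rule that[of x1])
      show "rderiv U u' < rderiv U x1" using x1 mono_onD[OF mono, of u' x1] z0 uu' by force
    qed (use x1 z0 ltV in auto)
  qed
  have between: "U x < V x" if "x \<in> {u..u'}" for x
    using two[OF that] ueq[of x] ueq'[of x] nt[of x] nt'[of x] that uu' by auto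
  show False
  proof (rule extremal_no_two_pieces[OF ex x0(1) _ x1(2),
        where la = "rderiv U u" and ua = "rderiv U u" and lb = "rderiv U u'" and ub = "rderiv U u'"
        and pa = u and qa = t and pb = u' and qb = t'])
    show "U x < V x" if "x \<in> {x0..x1}" for x
      using that between[of x] x0(4)[of x] x1(4)[of x] by fastforce
    show "rderiv U x \<in> {rderiv U u..rderiv U u}" if "x \<in> {u<..<t}" for x
      using that t uu' mono_onD[OF mono, of u x] mono_onD[OF mono, of x t] by auto
    show "rderiv U x \<in> {rderiv U u'..rderiv U u'}" if "x \<in> {u'<..<t'}" for x
      using that t' uu' mono_onD[OF mono, of u' x] mono_onD[OF mono, of x t'] by auto
  qed (use t t' x0 x1 uu' lt in auto)
qed

end

section \<open>Likelihood ratios\<close>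

text \<open>Gives the laws of the other signals in the two states densities with respect to one
  reference measure, so that they can be compared pointwise.\<close>

lemma PiM_density:
  fixes g :: "'a \<Rightarrow> real"
  assumes "finite J" and sf: "sigma_finite_measure M" and g: "g \<in> borel_measurable M" "\<And>x. 0 \<le> g x"
    and P: "prob_space (density M (\<lambda>x. ennreal (g x)))"
  shows "PiM J (\<lambda>_. density M (\<lambda>x. ennreal (g x))) = density (PiM J (\<lambda>_. M)) (\<lambda>y. ennreal (\<Prod>k\<in>J. g (y k)))"
proof -
  interpret M: sigma_finite_measure M by fact
  interpret M: product_sigma_finite "\<lambda>_. M" by standard
  interpret D: prob_space "density M (\<lambda>x. ennreal (g x))" by fact
  interpret D: product_sigma_finite "\<lambda>_. density M (\<lambda>x. ennreal (g x))" by standard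
  note g(1)[measurable]
  show ?thesis
  proof (rule D.PiM_eqI[symmetric, OF \<open>finite J\<close>])
    show "sets (density (PiM J (\<lambda>_. M)) (\<lambda>y. ennreal (\<Prod>k\<in>J. g (y k)))) = sets (PiM J (\<lambda>_. density M (\<lambda>x. ennreal (g x))))"
      by (simp cong: sets_PiM_cong)
    fix A assume A: "\<And>k. k \<in> J \<Longrightarrow> A k \<in> sets (density M (\<lambda>x. ennreal (g x)))"
    hence AM [measurable]: "\<And>k. k \<in> J \<Longrightarrow> A k \<in> sets M" by simp
    have [measurable]: "Pi\<^sub>E J A \<in> sets (PiM J (\<lambda>_. M))"
      using \<open>finite J\<close> AM by (intro sets_PiM_I_finite) auto
    have [measurable]: "(\<lambda>y. ennreal (\<Prod>k\<in>J. g (y k))) \<in> borel_measurable (PiM J (\<lambda>_. M))"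
      by measurable
    have "emeasure (density (PiM J (\<lambda>_. M)) (\<lambda>y. ennreal (\<Prod>k\<in>J. g (y k)))) (Pi\<^sub>E J A)
        = (\<integral>\<^sup>+y. ennreal (\<Prod>k\<in>J. g (y k)) * indicator (Pi\<^sub>E J A) y \<partial>PiM J (\<lambda>_. M))"
      by (rule emeasure_density) measurable
    also have "\<dots> = (\<integral>\<^sup>+y. (\<Prod>k\<in>J. ennreal (g (y k)) * indicator (A k) (y k)) \<partial>PiM J (\<lambda>_. M))"
    proof (intro nn_integral_cong)
      fix y assume y: "y \<in> space (PiM J (\<lambda>_. M))"
      show "ennreal (\<Prod>k\<in>J. g (y k)) * indicator (Pi\<^sub>E J A) y = (\<Prod>k\<in>J. ennreal (g (y k)) * indicator (A k) (y k))"
      proof (cases "y \<in> Pi\<^sub>E J A")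
        case True
        thus ?thesis using g(2) by (simp add: prod_ennreal PiE_mem)
      next
        case False
        then obtain k where "k \<in> J" "y k \<notin> A k" using y by (auto simp: space_PiM PiE_def)
        hence "(\<Prod>k\<in>J. ennreal (g (y k)) * indicator (A k) (y k)) = 0"
          using \<open>finite J\<close> by (intro prod_zero bexI[of _ k]) auto
        with False show ?thesis by simp
      qed
    qed
    also have "\<dots> = (\<Prod>k\<in>J. \<integral>\<^sup>+x. ennreal (g x) * indicator (A k) x \<partial>M)"
      using \<open>finite J\<close> AM by (intro M.product_nn_integral_prod) auto
    also have "\<dots> = (\<Prod>k\<in>J. emeasure (density M (\<lambda>x. ennreal (g x))) (A k))"
      using AM by (intro prod.cong refl emeasure_density[symmetric]) auto
    finally show "emeasure (density (PiM J (\<lambda>_. M)) (\<lambda>y. ennreal (\<Prod>k\<in>J. g (y k)))) (Pi\<^sub>E J A) =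
       (\<Prod>k\<in>J. emeasure (density M (\<lambda>x. ennreal (g x))) (A k))" .
  qed
qed

text \<open>With all coordinates but one fixed, each value of the product of the odds is taken at most once.\<close>
lemma AE_prod_odds_neq:
  assumes J: "finite J" "J \<noteq> {}" and M: "prob_space M" "sets M = sets borel"
    and sing: "\<And>t::real. emeasure M {t} = 0"
    and AE01: "AE t in M. 0 < t \<and> t < 1"
  shows "AE y in PiM J (\<lambda>_. M). (\<Prod>k\<in>J. y k / (1 - y k)) \<noteq> c"
proof -
  interpret M: prob_space M by fact
  interpret P: product_prob_space "\<lambda>_. M" by standard
  obtain k where k: "k \<in> J" using J by auto
  define K where "K = J - {k}"
  have JK: "J = insert k K" "finite K" "k \<notin> K" using k J by (auto simp: K_def)
  have [measurable_cong]: "sets M = sets borel" by fact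
  \<comment> \<open>The strict bounds on all coordinates make the product \<open>r\<close> of the
    fixed odds positive and \<open>t / (1 - t)\<close> injective.\<close>
  define E where "E = {y \<in> space (PiM J (\<lambda>_. M)). (\<Prod>k\<in>J. y k / (1 - y k)) = c \<and> (\<forall>j\<in>J. 0 < y j \<and> y j < 1)}"
  have E[measurable]: "E \<in> sets (PiM J (\<lambda>_. M))" unfolding E_def using J(1) by measurable
  have "emeasure (PiM J (\<lambda>_. M)) E = (\<integral>\<^sup>+y. indicator E y \<partial>PiM J (\<lambda>_. M))" by simp
  also have "\<dots> = (\<integral>\<^sup>+x. \<integral>\<^sup>+t. indicator E (x(k := t)) \<partial>M \<partial>PiM K (\<lambda>_. M))"
    unfolding JK(1) by (rule P.product_nn_integral_insert) (use JK E in auto)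
  also have "\<dots> = (\<integral>\<^sup>+x. 0 \<partial>PiM K (\<lambda>_. M))"
  proof (intro nn_integral_cong)
    fix x
    have uniq: "t = t'" if "x(k := t) \<in> E" "x(k := t') \<in> E" for t t'
    proof -
      define r where "r = (\<Prod>j\<in>K. x j / (1 - x j))"
      have pr: "(\<Prod>j\<in>J. (x(k := t)) j / (1 - (x(k := t)) j)) = t / (1 - t) * r" for t
      proof -
        have "(\<Prod>j\<in>K. (x(k := t)) j / (1 - (x(k := t)) j)) = r"
          unfolding r_def using JK(3) by (intro prod.cong) auto
        thus ?thesis unfolding JK(1) using JK(2,3) by simp
      qed
      have "x j > 0 \<and> x j < 1" if "j \<in> K" for j
        using \<open>x(k := t) \<in> E\<close> that JK by (auto simp: E_def split: if_splits)
      hence "r > 0" unfolding r_def by (intro prod_pos) auto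
      moreover have "t / (1 - t) * r = t' / (1 - t') * r"
        using that pr[of t] pr[of t'] by (simp add: E_def)
      moreover have "0 < t" "t < 1" "0 < t'" "t' < 1" using that JK by (auto simp: E_def)
      ultimately show ?thesis by (simp add: field_simps)
    qed
    have "AE t in M. x(k := t) \<notin> E"
    proof (cases "\<exists>t. x(k := t) \<in> E")
      case True
      then obtain t where t: "x(k := t) \<in> E" by blast
      have "AE s in M. s \<noteq> t"
        by (rule AE_I[where N = "{t}"]) (use sing M(2) in auto)
      thus ?thesis by eventually_elim (use uniq[OF t] in auto)
    qed auto
    hence "(\<integral>\<^sup>+t. indicator E (x(k := t)) \<partial>M) = (\<integral>\<^sup>+t. 0 \<partial>M)"
      by (intro nn_integral_cong_AE) (auto elim!: eventually_mono)
    thus "(\<integral>\<^sup>+t. indicator E (x(k := t)) \<partial>M) = 0" by simp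
  qed
  finally have "emeasure (PiM J (\<lambda>_. M)) E = 0" by simp
  hence "AE y in PiM J (\<lambda>_. M). y \<notin> E" by (intro AE_not_in null_setsI E)
  moreover have "AE y in PiM J (\<lambda>_. M). \<forall>j\<in>J. 0 < y j \<and> y j < 1"
    using J(1) AE01 M(1) by (intro AE_finite_allI AE_PiM_component) auto
  ultimately show ?thesis using AE_space
    by eventually_elim (auto simp: E_def)
qed

lemma lr_pos: "0 < s \<Longrightarrow> s < 1 \<Longrightarrow> lr s = ereal (s / (1 - s))"
  by (simp add: lr_def)

lemma LRset_eq_prod_odds:
  assumes "\<And>k. k \<in> K \<Longrightarrow> 0 < y k \<and> y k < 1"
  shows "LRset y K = ereal (\<Prod>k\<in>K. y k / (1 - y k))"
proof -
  have "LRset y K = (\<Prod>k\<in>K. ereal (y k / (1 - y k)))"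
    unfolding LRset_def using assms by (intro prod.cong refl lr_pos) auto
  thus ?thesis by (simp add: prod_ereal)
qed

lemma borel_measurable_lr [measurable]: "lr \<in> borel_measurable borel"
  unfolding lr_def[abs_def] by measurable

lemma borel_measurable_LRset [measurable]:
  "(\<lambda>y. LRset y K) \<in> borel_measurable (PiM I (\<lambda>_. lborel))" if "K \<subseteq> I"
proof -
  have "(\<lambda>y. lr (y k)) \<in> borel_measurable (PiM I (\<lambda>_. lborel))" if "k \<in> K" for k
  proof -
    have "(\<lambda>y. y k) \<in> PiM I (\<lambda>_. lborel) \<rightarrow>\<^sub>M (borel :: real measure)"
      using measurable_component_singleton[of k I "\<lambda>_. lborel"] \<open>K \<subseteq> I\<close> that by auto
    thus ?thesis by (rule measurable_compose[OF _ borel_measurable_lr])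
  qed
  thus ?thesis unfolding LRset_def by (intro borel_measurable_ereal_prod)
qed

text \<open>Moves cutoffs from the likelihood ratio to the bounded quantity
  \<open>1 / (1 + r)\<close>. The ends are consistent: \<open>inverse (lr 0)\<close> is infinite, so
  no \<open>r\<close> passes, and \<open>inverse (lr 1)\<close> is 0, so every \<open>r\<close>
  passes.\<close>

lemma inverse_lr_le_iff:
  assumes "r > 0" "0 \<le> \<theta>" "\<theta> \<le> 1"
  shows "inverse (lr \<theta>) \<le> ereal r \<longleftrightarrow> 1 / (1 + r) \<le> \<theta>"
proof -
  consider "\<theta> = 0" | "\<theta> = 1" | "0 < \<theta>" "\<theta> < 1" using assms by fastforce
  thus ?thesis
  proof cases
    case 3
    hence "inverse (lr \<theta>) = ereal ((1 - \<theta>) / \<theta>)" by (simp add: lr_pos)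
    thus ?thesis using 3 assms by (simp add: field_simps)
  qed (use assms in \<open>auto simp: lr_def\<close>)
qed

text \<open>\<open>int2\<close> says that the mean posterior equals the prior 1/2. Together with
  \<open>int1\<close> it makes both \<open>2 * s * f s\<close> and \<open>2 * (1 - s) * f s\<close>
  integrate to 1.\<close>

locale signals =
  fixes n i :: nat and a b :: real and f f' :: "real \<Rightarrow> real"
  assumes n: "n \<ge> 2" and i: "i < n" and ab: "0 \<le> a" "a < b" "b \<le> 1"
    and fpos: "\<forall>s\<in>{a..b}. f s > 0"
    and fder: "\<forall>s\<in>{a..b}. (f has_real_derivative f' s) (at s within {a..b})"
    and contf': "continuous_on {a..b} f'"
    and int1: "(LBINT s:{a..b}. f s) = 1"
    and int2: "(LBINT s:{a..b}. s * f s) = 1 / 2"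
begin

section \<open>Laws of the other agents' signals\<close>

definition J where "J = {..<n} - {i}"
definition dens_plus where "dens_plus s = indicator {a..b} s * (2 * s * f s)"
definition dens_minus where "dens_minus s = indicator {a..b} s * (2 * (1 - s) * f s)"
abbreviation "N \<equiv> PiM J (\<lambda>_. lborel :: real measure)"
abbreviation "FP \<equiv> Fplus a b f"
abbreviation "FM \<equiv> Fminus a b f"
abbreviation "PP \<equiv> PiM J (\<lambda>_. FP)"
abbreviation "PM \<equiv> PiM J (\<lambda>_. FM)"

lemma J: "finite J" "J \<noteq> {}" "i \<notin> J" "insert i J = {..<n}"
proof -
  show "J \<noteq> {}"
  proof -
    have "(if i = 0 then 1 else 0) \<in> J" using n unfolding J_def by auto
    thus ?thesis by auto
  qed
qed (use i in \<open>auto simp: J_def\<close>)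

lemma others_eq: "others n i M = PiM J (\<lambda>_. M)"
  by (simp add: others_def J_def)

lemma others_box_eq: "others_box a b n i = PiE J (\<lambda>_. {a..b})"
  by (simp add: others_box_def J_def)

lemma contf: "continuous_on {a..b} f"
  using fder by (meson DERIV_continuous continuous_on_eq_continuous_within)

lemma dens_plus_nonneg: "0 \<le> dens_plus s" and dens_minus_nonneg: "0 \<le> dens_minus s"
  using ab fpos by (auto simp: dens_plus_def dens_minus_def indicator_def intro!: mult_nonneg_nonneg intro: less_imp_le)

lemma cont_dens: "continuous_on {a..b} (\<lambda>s. 2 * s * f s)" "continuous_on {a..b} (\<lambda>s. 2 * (1 - s) * f s)"
  by (intro continuous_intros contf)+

lemma dens_plus_measurable [measurable]: "dens_plus \<in> borel_measurable borel"
  unfolding dens_plus_def[abs_def] using borel_measurable_continuous_on_indicator[OF _ cont_dens(1)] by simp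

lemma dens_minus_measurable [measurable]: "dens_minus \<in> borel_measurable borel"
  unfolding dens_minus_def[abs_def] using borel_measurable_continuous_on_indicator[OF _ cont_dens(2)] by simp

lemma FP_eq: "FP = density lborel (\<lambda>s. ennreal (dens_plus s))"
  by (simp add: Fplus_def dens_plus_def)

lemma FM_eq: "FM = density lborel (\<lambda>s. ennreal (dens_minus s))"
  by (simp add: Fminus_def dens_minus_def)

lemma prob_FP: "prob_space FP" and prob_FM: "prob_space FM"
proof -
  have i1: "set_integrable lborel {a..b} f" by (rule borel_integrable_atLeastAtMost'[OF contf])
  have i2: "set_integrable lborel {a..b} (\<lambda>s. s * f s)"
    by (rule borel_integrable_atLeastAtMost') (intro continuous_intros contf)
  have ip: "integrable lborel dens_plus" and im: "integrable lborel dens_minus"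
    using cont_dens[THEN borel_integrable_atLeastAtMost']
    by (simp_all add: set_integrable_def dens_plus_def[abs_def] dens_minus_def[abs_def])
  have "(\<integral>s. dens_plus s \<partial>lborel) = 2 * (LBINT s:{a..b}. s * f s)"
    unfolding dens_plus_def set_lebesgue_integral_def
    by (subst integral_mult_right_zero[symmetric]) (simp add: mult_ac)
  hence p: "(\<integral>s. dens_plus s \<partial>lborel) = 1" using int2 by simp
  have "(\<integral>s. dens_minus s \<partial>lborel) = (LBINT s:{a..b}. 2 * f s - 2 * (s * f s))"
    unfolding dens_minus_def set_lebesgue_integral_def by (simp add: algebra_simps)
  also have "\<dots> = 2 * (LBINT s:{a..b}. f s) - 2 * (LBINT s:{a..b}. s * f s)"
    using i1 i2 by (subst set_integral_diff) auto
  finally have m: "(\<integral>s. dens_minus s \<partial>lborel) = 1" using int1 int2 by simp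
  show "prob_space FP" unfolding FP_eq
    by (rule prob_spaceI) (simp add: emeasure_density nn_integral_eq_integral[OF ip] dens_plus_nonneg p cong: nn_integral_cong)
  show "prob_space FM" unfolding FM_eq
    by (rule prob_spaceI) (simp add: emeasure_density nn_integral_eq_integral[OF im] dens_minus_nonneg m cong: nn_integral_cong)
qed

sublocale FP: prob_space FP by (rule prob_FP)
sublocale FM: prob_space FM by (rule prob_FM)
sublocale PP: product_prob_space "\<lambda>_. FP" J by standard
sublocale PM: product_prob_space "\<lambda>_. FM" J by standard

lemma sets_F [measurable_cong, simp]: "sets FP = sets lborel" "sets FM = sets lborel"
  by (simp_all add: FP_eq FM_eq)

lemma sets_P [measurable_cong]: "sets PP = sets N" "sets PM = sets N"
  by (simp_all cong: sets_PiM_cong)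

lemma space_P: "space PP = PiE J (\<lambda>_. UNIV)" "space PM = PiE J (\<lambda>_. UNIV)" "space N = PiE J (\<lambda>_. UNIV)"
  by (simp_all add: space_PiM FP_eq FM_eq)

lemma AE_F: "AE s in FP. s \<in> {a..b} \<and> 0 < s \<and> s < 1" "AE s in FM. s \<in> {a..b} \<and> 0 < s \<and> s < 1"
proof -
  have ae: "AE s in lborel. s \<noteq> (0::real) \<and> s \<noteq> 1"
    using AE_lborel_singleton[of "0::real"] AE_lborel_singleton[of "1::real"] by eventually_elim auto
  have *: "s \<in> {a..b} \<and> 0 < s \<and> s < 1" if "s \<noteq> 0 \<and> s \<noteq> 1" "0 < dens_plus s \<or> 0 < dens_minus s" for s
    using that ab by (cases "s \<in> {a..b}") (auto simp: dens_plus_def dens_minus_def)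
  have "AE s in lborel. 0 < ennreal (dens_plus s) \<longrightarrow> s \<in> {a..b} \<and> 0 < s \<and> s < 1"
    "AE s in lborel. 0 < ennreal (dens_minus s) \<longrightarrow> s \<in> {a..b} \<and> 0 < s \<and> s < 1"
    using ae by (eventually_elim, use * in \<open>simp add: ennreal_less_zero_iff\<close>)+
  thus "AE s in FP. s \<in> {a..b} \<and> 0 < s \<and> s < 1" "AE s in FM. s \<in> {a..b} \<and> 0 < s \<and> s < 1"
    unfolding FP_eq FM_eq by (subst AE_density; simp)+
qed

lemma singleton_null: "emeasure FP {t} = 0" "emeasure FM {t} = 0"
proof -
  have "AE s in lborel. s \<notin> {t}" using AE_lborel_singleton[of t] by simp
  hence "AE s in FP. s \<notin> {t}" "AE s in FM. s \<notin> {t}"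
    unfolding FP_eq FM_eq by (auto simp: AE_density elim!: eventually_mono)
  thus "emeasure FP {t} = 0" "emeasure FM {t} = 0"
    by (auto simp: AE_iff_measurable[OF _ refl] FP_eq FM_eq space_density)
qed

text \<open>The signals 0 and 1 are left out because their odds are zero or infinite; almost surely
  they do not occur.\<close>

definition inbox where "inbox y \<longleftrightarrow> (\<forall>k\<in>J. y k \<in> {a..b} \<and> 0 < y k \<and> y k < 1)"

lemma AE_inbox: "AE y in PP. inbox y" "AE y in PM. inbox y"
  unfolding inbox_def using J(1) AE_F
  by (auto intro!: AE_finite_allI AE_PiM_component prob_FP prob_FM)

definition joint_plus where "joint_plus y = (\<Prod>k\<in>J. dens_plus (y k))"
definition joint_minus where "joint_minus y = (\<Prod>k\<in>J. dens_minus (y k))"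
text \<open>\<open>indiff y\<close> is the type \<open>u\<close> with \<open>LR(u, y) = 1\<close>, so type \<open>u\<close> wants the good iff \<open>indiff y \<le> u\<close>.\<close>
definition indiff where "indiff y = joint_minus y / (joint_plus y + joint_minus y)"

lemma PP_eq: "PP = density N (\<lambda>y. ennreal (joint_plus y))" and PM_eq: "PM = density N (\<lambda>y. ennreal (joint_minus y))"
  unfolding FP_eq FM_eq joint_plus_def joint_minus_def using prob_FP prob_FM
  by (auto intro!: PiM_density J(1) lborel.sigma_finite_measure_axioms dens_plus_nonneg dens_minus_nonneg simp: FP_eq FM_eq)

lemma joint_measurable [measurable]: "joint_plus \<in> borel_measurable N" "joint_minus \<in> borel_measurable N" "indiff \<in> borel_measurable N"
  unfolding indiff_def[abs_def] joint_plus_def[abs_def] joint_minus_def[abs_def] by measurable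

lemma indiff_sets: "{y \<in> space PP. indiff y \<le> c} \<in> sets PP" "{y \<in> space PM. indiff y \<le> c} \<in> sets PM"
  "{y \<in> space PP. indiff y = c} \<in> sets PP" "{y \<in> space PM. indiff y = c} \<in> sets PM"
  by measurable

lemma joint_plus_nonneg: "0 \<le> joint_plus y" and joint_minus_nonneg: "0 \<le> joint_minus y"
  by (auto simp: joint_plus_def joint_minus_def intro!: prod_nonneg dens_plus_nonneg dens_minus_nonneg)

text \<open>The normalization of signals makes \<open>s / (1 - s)\<close> the ratio of the two
  densities at \<open>s\<close>, so \<open>r\<close> is the ratio of \<open>joint_plus y\<close> to
  \<open>joint_minus y\<close>.\<close>

lemma inbox_indiff:
  assumes "inbox y"
  defines "r \<equiv> (\<Prod>k\<in>J. y k / (1 - y k))"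
  shows "0 < r" "LRset y J = ereal r" "indiff y = 1 / (1 + r)"
proof -
  show r: "0 < r" unfolding r_def using assms by (intro prod_pos) (auto simp: inbox_def)
  show "LRset y J = ereal r" unfolding r_def using assms by (intro LRset_eq_prod_odds) (auto simp: inbox_def)
  have "joint_plus y = (\<Prod>k\<in>J. y k / (1 - y k) * dens_minus (y k))"
    unfolding joint_plus_def using assms(1) by (intro prod.cong) (auto simp: inbox_def dens_plus_def dens_minus_def field_simps)
  hence joint_plus: "joint_plus y = r * joint_minus y" unfolding joint_minus_def r_def prod.distrib .
  have "joint_minus y > 0" unfolding joint_minus_def
    using assms(1) fpos by (intro prod_pos) (auto simp: inbox_def dens_minus_def)
  moreover have "r * joint_minus y + joint_minus y = (1 + r) * joint_minus y" by (simp add: algebra_simps)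
  ultimately show "indiff y = 1 / (1 + r)" unfolding indiff_def joint_plus using r by simp
qed

text \<open>The source of the continuity of \<open>A\<close> and \<open>B\<close>: since
  \<open>1 / indiff y = 1 + r\<close>, an atom of \<open>indiff\<close> would be an atom of the
  product of the odds.\<close>

lemma AE_indiff_neq: "AE y in PP. indiff y \<noteq> c" "AE y in PM. indiff y \<noteq> c"
proof -
  have "indiff y \<noteq> c" if "inbox y" "(\<Prod>k\<in>J. y k / (1 - y k)) \<noteq> 1 / c - 1" for y
  proof -
    have "1 / indiff y = 1 + (\<Prod>k\<in>J. y k / (1 - y k))" using inbox_indiff(3)[OF that(1)] by simp
    thus ?thesis using that(2) by auto
  qed
  moreover have "AE y in PP. (\<Prod>k\<in>J. y k / (1 - y k)) \<noteq> 1 / c - 1"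
    using AE_F(1) by (intro AE_prod_odds_neq J prob_FP singleton_null) auto
  moreover have "AE y in PM. (\<Prod>k\<in>J. y k / (1 - y k)) \<noteq> 1 / c - 1"
    using AE_F(2) by (intro AE_prod_odds_neq J prob_FM singleton_null) auto
  ultimately show "AE y in PP. indiff y \<noteq> c" "AE y in PM. indiff y \<noteq> c"
    using AE_inbox by (auto elim!: eventually_elim2)
qed

lemma indiff_range:
  assumes "inbox y"
  shows "0 < indiff y" "indiff y \<le> 1"
proof -
  define r where "r = (\<Prod>k\<in>J. y k / (1 - y k))"
  have "0 < r" "indiff y = 1 / (1 + r)" using inbox_indiff[OF assms] by (simp_all add: r_def)
  thus "0 < indiff y" "indiff y \<le> 1" by simp_all
qed

text \<open>Written as distribution functions of \<open>indiff\<close>, so that continuity amounts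
  to the absence of atoms.\<close>

definition A where "A \<theta> = cdf (distr PP borel indiff) \<theta>"
definition B where "B \<theta> = cdf (distr PM borel indiff) \<theta>"

lemma AB_eq: "A \<theta> = measure PP {y \<in> space PP. indiff y \<le> \<theta>}" "B \<theta> = measure PM {y \<in> space PM. indiff y \<le> \<theta>}"
  unfolding A_def B_def cdf_def by (simp_all add: measure_distr vimage_def Int_def conj_commute)

lemma AB_integral:
  "A \<theta> = (\<integral>y. indicator {y. indiff y \<le> \<theta>} y \<partial>PP)" "B \<theta> = (\<integral>y. indicator {y. indiff y \<le> \<theta>} y \<partial>PM)"
  unfolding AB_eq by (simp_all add: Int_def conj_commute)

lemma cont_AB: "isCont A \<theta>" "isCont B \<theta>"
proof -
  interpret DP: real_distribution "distr PP borel indiff" by (rule PP.real_distribution_distr) simp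
  interpret DM: real_distribution "distr PM borel indiff" by (rule PM.real_distribution_distr) simp
  have "measure (distr PP borel indiff) {\<theta>} = 0"
    using AE_indiff_neq(1)[of \<theta>] PP.prob_Collect_eq_0[OF indiff_sets(3)]
    by (simp add: measure_distr vimage_def Int_def conj_commute)
  thus "isCont A \<theta>" unfolding A_def[abs_def] by (simp add: DP.isCont_cdf)
  have "measure (distr PM borel indiff) {\<theta>} = 0"
    using AE_indiff_neq(2)[of \<theta>] PM.prob_Collect_eq_0[OF indiff_sets(4)]
    by (simp add: measure_distr vimage_def Int_def conj_commute)
  thus "isCont B \<theta>" unfolding B_def[abs_def] by (simp add: DM.isCont_cdf)
qed

lemma integrable_bounded:
  fixes \<phi> :: "(nat \<Rightarrow> real) \<Rightarrow> real"
  assumes "\<phi> \<in> borel_measurable N" "\<And>y. y \<in> PiE J (\<lambda>_. {a..b}) \<Longrightarrow> \<phi> y \<in> {0..1}"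
  shows "integrable PP \<phi>" "integrable PM \<phi>"
proof -
  have bd: "norm (\<phi> y) \<le> 1" if "inbox y" "y \<in> PiE J (\<lambda>_. UNIV)" for y
    using assms(2)[of y] that by (auto simp: inbox_def PiE_def Pi_def)
  show "integrable PP \<phi>"
  proof (rule PP.integrable_const_bound[where B = 1])
    show "AE y in PP. norm (\<phi> y) \<le> 1" using AE_inbox(1) AE_space by eventually_elim (use bd in \<open>auto simp: space_P\<close>)
  qed (use assms(1) in simp)
  show "integrable PM \<phi>"
  proof (rule PM.integrable_const_bound[where B = 1])
    show "AE y in PM. norm (\<phi> y) \<le> 1" using AE_inbox(2) AE_space by eventually_elim (use bd in \<open>auto simp: space_P\<close>)
  qed (use assms(1) in simp)
qed

text \<open>The payoff of type \<open>v\<close> integrates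
  \<open>v * joint_plus y - (1 - v) * joint_minus y\<close> against \<open>\<phi>\<close>. It is
  largest when \<open>\<phi>\<close> is 1 where this factor is nonnegative and 0 elsewhere, which up
  to points of density zero is the event \<open>indiff y \<le> v\<close>.\<close>

lemma neyman_pearson:
  fixes \<phi> :: "(nat \<Rightarrow> real) \<Rightarrow> real"
  assumes \<phi>: "\<phi> \<in> borel_measurable N" "\<And>y. y \<in> PiE J (\<lambda>_. {a..b}) \<Longrightarrow> \<phi> y \<in> {0..1}"
    and v: "0 \<le> v" "v \<le> 1"
  shows "v * (\<integral>y. \<phi> y \<partial>PP) - (1 - v) * (\<integral>y. \<phi> y \<partial>PM) \<le> v * A v - (1 - v) * B v"
proof -
  define ch where "ch = (indicator {y. indiff y \<le> v} :: (nat \<Rightarrow> real) \<Rightarrow> real)"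
  have ch: "ch \<in> borel_measurable N" unfolding ch_def by measurable
  have ch01: "ch y \<in> {0..1}" for y by (auto simp: ch_def indicator_def)
  have eq: "v * (\<integral>y. g y \<partial>PP) - (1 - v) * (\<integral>y. g y \<partial>PM) = (\<integral>y. (v * joint_plus y - (1 - v) * joint_minus y) * g y \<partial>N)"
    "integrable N (\<lambda>y. (v * joint_plus y - (1 - v) * joint_minus y) * g y)"
    if g: "g \<in> borel_measurable N" "\<And>y. y \<in> PiE J (\<lambda>_. {a..b}) \<Longrightarrow> g y \<in> {0..1}" for g :: "(nat \<Rightarrow> real) \<Rightarrow> real"
  proof -
    have ip: "integrable N (\<lambda>y. joint_plus y * g y)" and im: "integrable N (\<lambda>y. joint_minus y * g y)"
      using integrable_bounded[OF g] unfolding PP_eq PM_eq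
      by (simp_all add: integrable_density g(1) joint_plus_nonneg joint_minus_nonneg)
    have "(\<integral>y. g y \<partial>PP) = (\<integral>y. joint_plus y * g y \<partial>N)" "(\<integral>y. g y \<partial>PM) = (\<integral>y. joint_minus y * g y \<partial>N)"
      unfolding PP_eq PM_eq by (simp_all add: integral_density g(1) joint_plus_nonneg joint_minus_nonneg)
    moreover have "(\<lambda>y. (v * joint_plus y - (1 - v) * joint_minus y) * g y) = (\<lambda>y. v * (joint_plus y * g y) - (1 - v) * (joint_minus y * g y))"
      by (simp add: fun_eq_iff algebra_simps)
    ultimately show "v * (\<integral>y. g y \<partial>PP) - (1 - v) * (\<integral>y. g y \<partial>PM) = (\<integral>y. (v * joint_plus y - (1 - v) * joint_minus y) * g y \<partial>N)"
      "integrable N (\<lambda>y. (v * joint_plus y - (1 - v) * joint_minus y) * g y)"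
      using ip im by simp_all
  qed
  have "(\<integral>y. (v * joint_plus y - (1 - v) * joint_minus y) * \<phi> y \<partial>N) \<le> (\<integral>y. (v * joint_plus y - (1 - v) * joint_minus y) * ch y \<partial>N)"
  proof (rule integral_mono[OF eq(2)[OF \<phi>] eq(2)[OF ch ch01]])
    fix y assume y: "y \<in> space N"
    define d where "d = v * joint_plus y - (1 - v) * joint_minus y"
    show "(v * joint_plus y - (1 - v) * joint_minus y) * \<phi> y \<le> (v * joint_plus y - (1 - v) * joint_minus y) * ch y"
      unfolding d_def[symmetric]
    proof (cases "y \<in> PiE J (\<lambda>_. {a..b})")
      \<comment> \<open>Outside the box \<open>\<phi>\<close> is unconstrained, but both densities
        vanish there.\<close>
      case False
      then obtain k where "k \<in> J" "y k \<notin> {a..b}" using y by (force simp: PiE_iff space_P)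
      hence "joint_plus y = 0" "joint_minus y = 0" using J(1) unfolding joint_plus_def joint_minus_def
        by (auto intro!: prod_zero bexI[of _ k] simp: dens_plus_def dens_minus_def)
      thus "d * \<phi> y \<le> d * ch y" by (simp add: d_def)
    next
      case True
      hence 01: "0 \<le> \<phi> y" "\<phi> y \<le> 1" using \<phi>(2) by auto
      show "d * \<phi> y \<le> d * ch y"
      \<comment> \<open>If both densities vanish, \<open>indiff y\<close> is the default value 0 of
        a division by zero and does not reflect the sign of \<open>d\<close>; but then
        \<open>d = 0\<close>.\<close>
      proof (cases "joint_plus y + joint_minus y = 0")
        case True
        hence "joint_plus y = 0" "joint_minus y = 0" using joint_plus_nonneg[of y] joint_minus_nonneg[of y] by auto
        thus ?thesis by (simp add: d_def)
      next
        case False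
        hence pos: "joint_plus y + joint_minus y > 0" using joint_plus_nonneg[of y] joint_minus_nonneg[of y] by auto
        have iff: "indiff y \<le> v \<longleftrightarrow> d \<ge> 0"
          unfolding indiff_def d_def using pos by (simp add: field_simps)
        show ?thesis
        proof (cases "d \<ge> 0")
          case True
          thus ?thesis using iff 01 by (simp add: ch_def mult_left_le)
        next
          case False
          thus ?thesis using iff 01 by (simp add: ch_def mult_nonpos_nonneg)
        qed
      qed
    qed
  qed
  thus ?thesis using eq(1)[OF \<phi>] eq(1)[OF ch ch01] AB_integral[of v] by (simp add: ch_def)
qed

sublocale screening A B
proof
  show "continuous_on {0..1} A" "continuous_on {0..1} B"
    using cont_AB by (auto intro!: continuous_at_imp_continuous_on)
  have "AE y in PP. \<not> indiff y \<le> 0" "AE y in PM. \<not> indiff y \<le> 0"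
    using AE_inbox by (auto elim!: eventually_mono dest!: indiff_range(1))
  thus "A 0 = 0" "B 0 = 0" unfolding AB_eq PP.prob_Collect_eq_0[OF indiff_sets(1)] PM.prob_Collect_eq_0[OF indiff_sets(2)] .
  have "AE y in PP. indiff y \<le> 1" "AE y in PM. indiff y \<le> 1"
    using AE_inbox by (auto elim!: eventually_mono dest!: indiff_range(2))
  thus "A 1 = 1" "B 1 = 1" unfolding AB_eq PP.prob_Collect_eq_1[OF indiff_sets(1)] PM.prob_Collect_eq_1[OF indiff_sets(2)] .
  fix \<theta> v :: real assume v: "v \<in> {0..1}"
  show "v * A \<theta> - (1 - v) * B \<theta> \<le> v * A v - (1 - v) * B v"
    unfolding AB_integral[of \<theta>]
  proof (rule neyman_pearson)
    show "(indicator {y. indiff y \<le> \<theta>} :: _ \<Rightarrow> real) \<in> borel_measurable N" by measurable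
  qed (use v in \<open>auto simp: indicator_def\<close>)
qed

lemma threshold_integral:
  assumes "0 \<le> \<theta>" "\<theta> \<le> 1"
  shows "(\<integral>y. (if inverse (lr \<theta>) \<le> LRset y J then 1 else 0) \<partial>PP) = A \<theta>"
    and "(\<integral>y. (if inverse (lr \<theta>) \<le> LRset y J then 1 else 0) \<partial>PM) = B \<theta>"
proof -
  have eq: "(if inverse (lr \<theta>) \<le> LRset y J then 1 else 0) = (indicator {y. indiff y \<le> \<theta>} y :: real)" if "inbox y" for y
    using inbox_indiff[OF that] inverse_lr_le_iff[OF inbox_indiff(1)[OF that] assms] by (simp add: indicator_def)
  show "(\<integral>y. (if inverse (lr \<theta>) \<le> LRset y J then 1 else 0) \<partial>PP) = A \<theta>"
    unfolding AB_integral
  proof (rule integral_cong_AE)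
    show "(\<lambda>y. if inverse (lr \<theta>) \<le> LRset y J then 1 else 0 :: real) \<in> borel_measurable PP"
      unfolding measurable_cong_sets[OF sets_P(1) refl] by measurable
    show "(indicator {y. indiff y \<le> \<theta>} :: _ \<Rightarrow> real) \<in> borel_measurable PP" by measurable
    show "AE y in PP. (if inverse (lr \<theta>) \<le> LRset y J then 1 else 0) = (indicator {y. indiff y \<le> \<theta>} y :: real)"
      using AE_inbox(1) by eventually_elim (rule eq)
  qed
  show "(\<integral>y. (if inverse (lr \<theta>) \<le> LRset y J then 1 else 0) \<partial>PM) = B \<theta>"
    unfolding AB_integral
  proof (rule integral_cong_AE)
    show "(\<lambda>y. if inverse (lr \<theta>) \<le> LRset y J then 1 else 0 :: real) \<in> borel_measurable PM"
      unfolding measurable_cong_sets[OF sets_P(2) refl] by measurable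
    show "(indicator {y. indiff y \<le> \<theta>} :: _ \<Rightarrow> real) \<in> borel_measurable PM" by measurable
    show "AE y in PM. (if inverse (lr \<theta>) \<le> LRset y J then 1 else 0) = (indicator {y. indiff y \<le> \<theta>} y :: real)"
      using AE_inbox(2) by eventually_elim (rule eq)
  qed
qed

end

section \<open>From mechanisms to interim utilities\<close>

text \<open>A mechanism is only constrained on the box, so Fubini is applied to its truncation to \<open>[0, 1]\<close>.\<close>
lemma integral_report_fubini:
  fixes \<phi> :: "('i \<Rightarrow> real) \<Rightarrow> real"
  assumes F: "prob_space F" "sets F = sets borel" and AE: "AE t in F. t \<in> {a..b}"
    and J: "finite J" "i \<notin> J"
    and \<phi>: "\<phi> \<in> borel_measurable (PiM (insert i J) (\<lambda>_. lborel))"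
      "\<And>s. s \<in> PiE (insert i J) (\<lambda>_. {a..b}) \<Longrightarrow> \<phi> s \<in> {0..1}"
  shows "\<exists>p. p \<in> borel_measurable borel \<and> (\<forall>t\<in>{a..b}. p t = (\<integral>y. \<phi> (y(i := t)) \<partial>PiM J (\<lambda>_. F))) \<and>
            (\<forall>t. 0 \<le> p t \<and> p t \<le> 1) \<and> (\<integral>s. \<phi> s \<partial>PiM (insert i J) (\<lambda>_. F)) = (\<integral>t. p t \<partial>F)"
proof -
  interpret F: prob_space F by fact
  interpret P: product_prob_space "\<lambda>_. F" by standard
  interpret PJ: prob_space "PiM J (\<lambda>_. F)" by (rule prob_space_PiM) (rule F(1))
  interpret PI: prob_space "PiM (insert i J) (\<lambda>_. F)" by (rule prob_space_PiM) (rule F(1))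
  have sets_lborel: "sets (PiM I (\<lambda>_. F)) = sets (PiM I (\<lambda>_. lborel))" for I :: "'i set"
    using F(2) by (intro sets_PiM_cong) auto
  define c where "c s = max 0 (min 1 (\<phi> s))" for s
  have \<phi>': "\<phi> \<in> borel_measurable (PiM (insert i J) (\<lambda>_. F))"
    using \<phi>(1) by (simp add: measurable_cong_sets[OF sets_lborel refl])
  have c [measurable]: "c \<in> borel_measurable (PiM (insert i J) (\<lambda>_. F))"
    unfolding c_def[abs_def] using \<phi>' by measurable
  have c01: "0 \<le> c s" "c s \<le> 1" for s by (auto simp: c_def)
  have c\<phi>: "c s = \<phi> s" if "s \<in> PiE (insert i J) (\<lambda>_. {a..b})" for s
    using \<phi>(2)[OF that] by (auto simp: c_def)
  have AEbox: "AE s in PiM I (\<lambda>_. F). s \<in> PiE I (\<lambda>_. {a..b})" if "finite I" for I :: "'i set"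
  proof -
    have "AE s in PiM I (\<lambda>_. F). \<forall>k\<in>I. s k \<in> {a..b}"
      using that AE F(1) by (intro AE_finite_allI AE_PiM_component) auto
    thus ?thesis using AE_space by eventually_elim (auto simp: space_PiM PiE_iff)
  qed
  define p where "p t = (\<integral>y. c (y(i := t)) \<partial>PiM J (\<lambda>_. F))" for t
  have m1: "(\<lambda>(y, t). c (y(i := t))) \<in> borel_measurable (PiM J (\<lambda>_. F) \<Otimes>\<^sub>M F)"
    using measurable_compose[OF measurable_add_dim[of i J "\<lambda>_. F"] c] by (simp add: case_prod_beta')
  have m2: "(\<lambda>(t, y). c (y(i := t))) \<in> borel_measurable (F \<Otimes>\<^sub>M PiM J (\<lambda>_. F))"
    using measurable_pair_swap[OF m1] by (simp add: case_prod_beta')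
  show ?thesis
  proof (intro exI[of _ p] conjI ballI allI)
    have "p \<in> borel_measurable F" unfolding p_def[abs_def] using m2
      by (rule PJ.borel_measurable_lebesgue_integral)
    thus "p \<in> borel_measurable borel" by (simp add: measurable_cong_sets[OF F(2) refl])
    have mt: "(\<lambda>y. c (y(i := t))) \<in> borel_measurable (PiM J (\<lambda>_. F))" for t
      using measurable_compose[OF measurable_Pair1'[of t F] m2] F(2) sets_eq_imp_space_eq[OF F(2)] by simp
    show "0 \<le> p t" for t unfolding p_def by (intro integral_nonneg_AE AE_I2 c01)
    have "p t \<le> (\<integral>y. 1 \<partial>PiM J (\<lambda>_. F))" for t unfolding p_def
      using c01 by (intro integral_mono PJ.integrable_const_bound[where B = 1] mt) auto
    thus "p t \<le> 1" for t by (simp add: PJ.prob_space)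
    show "p t = (\<integral>y. \<phi> (y(i := t)) \<partial>PiM J (\<lambda>_. F))" if t: "t \<in> {a..b}" for t
      unfolding p_def
    proof (rule integral_cong_AE[OF mt])
      have "(\<lambda>y. y(i := t)) \<in> PiM J (\<lambda>_. F) \<rightarrow>\<^sub>M PiM (insert i J) (\<lambda>_. F)"
        using sets_eq_imp_space_eq[OF F(2)] by (intro measurable_fun_upd[where J = J]) auto
      from measurable_compose[OF this \<phi>'] show "(\<lambda>y. \<phi> (y(i := t))) \<in> borel_measurable (PiM J (\<lambda>_. F))" .
      show "AE y in PiM J (\<lambda>_. F). c (y(i := t)) = \<phi> (y(i := t))"
        using AEbox[OF J(1)] by eventually_elim (intro c\<phi> PiE_fun_upd t)
    qed
    have "(\<integral>s. \<phi> s \<partial>PiM (insert i J) (\<lambda>_. F)) = (\<integral>s. c s \<partial>PiM (insert i J) (\<lambda>_. F))"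
      using AEbox[of "insert i J"] J(1) c\<phi> by (intro integral_cong_AE \<phi>' c) (auto elim!: eventually_mono)
    also have "\<dots> = (\<integral>y. \<integral>t. c (y(i := t)) \<partial>F \<partial>PiM J (\<lambda>_. F))"
      using c01 by (intro P.product_integral_insert J PI.integrable_const_bound[where B = 1] c) auto
    also have "\<dots> = (\<integral>t. p t \<partial>F)"
    proof -
      interpret pair_prob_space "PiM J (\<lambda>_. F)" F by standard
      have "integrable (PiM J (\<lambda>_. F) \<Otimes>\<^sub>M F) (\<lambda>(y, t). c (y(i := t)))"
        using c01 by (intro P.integrable_const_bound[where B = 1] m1) auto
      from Fubini_integral[OF this] show ?thesis by (simp add: p_def)
    qed
    finally show "(\<integral>s. \<phi> s \<partial>PiM (insert i J) (\<lambda>_. F)) = (\<integral>t. p t \<partial>F)" .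
  qed
qed

context signals begin

text \<open>With \<open>p = U + (1 - s) * m\<close> and \<open>q = s * m - U\<close>, the allocation
  \<open>s * p + (1 - s) * q\<close> becomes \<open>(2 * s - 1) * U + 2 * s * (1 - s) * m\<close>.
  Times \<open>f\<close>, the coefficient of \<open>m\<close> is \<open>bdry_weight\<close>;
  integration by parts leaves its boundary values and moves its derivative onto \<open>U\<close>,
  which gives \<open>util_weight\<close>.\<close>

definition bdry_weight where "bdry_weight s = 2 * (s * (1 - s) * f s)"
definition bdry_weight' where "bdry_weight' s = 2 * ((1 - 2 * s) * f s + s * (1 - s) * f' s)"
definition util_weight where "util_weight s = (2 * s - 1) * f s - bdry_weight' s"
definition welfare where "welfare W = bdry_weight b * W b - bdry_weight a * W a + integral {a..b} (\<lambda>s. util_weight s * W s)"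

lemma cont_bdry_weight': "continuous_on {a..b} bdry_weight'"
  unfolding bdry_weight'_def[abs_def] by (intro continuous_intros contf contf')

lemma cont_util_weight: "continuous_on {a..b} util_weight"
  unfolding util_weight_def[abs_def] by (intro continuous_intros contf cont_bdry_weight')

lemma deriv_bdry_weight: "s \<in> {a..b} \<Longrightarrow> (bdry_weight has_real_derivative bdry_weight' s) (at s within {a..b})"
  unfolding bdry_weight_def[abs_def] bdry_weight'_def using fder
  by (auto intro!: derivative_eq_intros simp: algebra_simps)

text \<open>\<open>welfare U\<close> contains no \<open>m\<close>: feasible mechanisms with the same
  interim utility on \<open>[a, b]\<close> allocate equally often, whichever subgradients they
  select at kinks.\<close>

lemma welfare_by_parts:
  assumes sg: "subgrad_on {a..b} U m" and m: "\<And>s. s \<in> {a..b} \<Longrightarrow> \<bar>m s\<bar> \<le> 2"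
  shows "set_integrable lborel {a..b} (\<lambda>s. f s * (s * (U s + (1 - s) * m s) + (1 - s) * (s * m s - U s)))"
    and "(LBINT s:{a..b}. f s * (s * (U s + (1 - s) * m s) + (1 - s) * (s * m s - U s))) = welfare U"
proof -
  note ibp = subgrad_on_integral_by_parts[OF sg m less_imp_le[OF ab(2)] deriv_bdry_weight cont_bdry_weight']
  have cU: "continuous_on {a..b} U"
    by (rule lipschitz_imp_continuous_on[OF subgrad_on_lipschitz[OF sg m]])
  have eq1: "f s * (s * (U s + (1 - s) * m s) + (1 - s) * (s * m s - U s)) = (2 * s - 1) * f s * U s + bdry_weight s * m s" for s
    by (simp add: bdry_weight_def algebra_simps)
  show si: "set_integrable lborel {a..b} (\<lambda>s. f s * (s * (U s + (1 - s) * m s) + (1 - s) * (s * m s - U s)))"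
    unfolding eq1 by (intro set_integral_add ibp(1) borel_integrable_atLeastAtMost' continuous_intros contf cU)
  have "((\<lambda>s. util_weight s * U s) has_integral integral {a..b} (\<lambda>s. util_weight s * U s)) {a..b}"
    by (intro integrable_integral integrable_continuous_interval continuous_intros cont_util_weight cU)
  from has_integral_add[OF ibp(2) this]
  have "((\<lambda>s. (2 * s - 1) * f s * U s + bdry_weight s * m s) has_integral welfare U) {a..b}"
    by (simp add: welfare_def util_weight_def algebra_simps)
  hence "integral {a..b} (\<lambda>s. f s * (s * (U s + (1 - s) * m s) + (1 - s) * (s * m s - U s))) = welfare U"
    unfolding eq1 by (rule integral_unique)
  thus "(LBINT s:{a..b}. f s * (s * (U s + (1 - s) * m s) + (1 - s) * (s * m s - U s))) = welfare U"
    using set_borel_integral_eq_integral(2)[OF si] by simp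
qed

section \<open>Bounding a feasible mechanism by its interim utility\<close>

definition alloc_plus where "alloc_plus x t = (\<integral>y. x (y(i := t)) i \<partial>PP)" for x :: "(nat \<Rightarrow> real) \<Rightarrow> nat \<Rightarrow> real"
definition alloc_minus where "alloc_minus x t = (\<integral>y. x (y(i := t)) i \<partial>PM)" for x :: "(nat \<Rightarrow> real) \<Rightarrow> nat \<Rightarrow> real"

lemma interim_eq: "interim_util a b f n x i u t = u * alloc_plus x t - (1 - u) * alloc_minus x t"
  by (simp add: interim_util_def others_eq alloc_plus_def alloc_minus_def)

lemma mechanism_slice:
  assumes "is_mechanism a b n x" "t \<in> {a..b}"
  shows "(\<lambda>y. x (y(i := t)) i) \<in> borel_measurable N"
    "\<And>y. y \<in> PiE J (\<lambda>_. {a..b}) \<Longrightarrow> x (y(i := t)) i \<in> {0..1}"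
proof -
  have "(\<lambda>y. y(i := t)) \<in> N \<rightarrow>\<^sub>M PiM (insert i J) (\<lambda>_. lborel)"
    by (intro measurable_fun_upd[where J = J]) auto
  moreover have "(\<lambda>s. x s i) \<in> borel_measurable (PiM (insert i J) (\<lambda>_. lborel))"
    using assms i J(4) by (simp add: is_mechanism_def)
  ultimately show "(\<lambda>y. x (y(i := t)) i) \<in> borel_measurable N" by (rule measurable_compose)
  fix y assume "y \<in> PiE J (\<lambda>_. {a..b})"
  hence "y(i := t) \<in> PiE (insert i J) (\<lambda>_. {a..b})"
    using assms(2) by (auto simp: PiE_iff extensional_def)
  thus "x (y(i := t)) i \<in> {0..1}" using assms(1) i J(4) by (simp add: is_mechanism_def)
qed

lemma ex_alloc_eq:
  assumes x: "is_mechanism a b n x"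
  shows "set_integrable lborel {a..b} (\<lambda>t. f t * (t * alloc_plus x t + (1 - t) * alloc_minus x t))"
    and "ex_alloc a b f n x i = (LBINT t:{a..b}. f t * (t * alloc_plus x t + (1 - t) * alloc_minus x t))"
    and "t \<in> {a..b} \<Longrightarrow> alloc_plus x t \<in> {0..1}" "t \<in> {a..b} \<Longrightarrow> alloc_minus x t \<in> {0..1}"
proof -
  have meas: "(\<lambda>s. x s i) \<in> borel_measurable (PiM (insert i J) (\<lambda>_. lborel))"
    and rng: "\<And>s. s \<in> PiE (insert i J) (\<lambda>_. {a..b}) \<Longrightarrow> x s i \<in> {0..1}"
    using x i J(4) by (auto simp: is_mechanism_def)
  have AEF: "AE t in FP. t \<in> {a..b}" "AE t in FM. t \<in> {a..b}"
    using AE_F by (auto elim: eventually_mono)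
  from integral_report_fubini[OF prob_FP _ AEF(1) J(1,3) meas rng]
  obtain p where p: "p \<in> borel_measurable borel" "\<And>t. t \<in> {a..b} \<Longrightarrow> p t = alloc_plus x t" "\<And>t. 0 \<le> p t \<and> p t \<le> 1"
      "(\<integral>s. x s i \<partial>PiM {..<n} (\<lambda>_. FP)) = (\<integral>t. p t \<partial>FP)"
    unfolding J(4) alloc_plus_def by auto
  from integral_report_fubini[OF prob_FM _ AEF(2) J(1,3) meas rng]
  obtain q where q: "q \<in> borel_measurable borel" "\<And>t. t \<in> {a..b} \<Longrightarrow> q t = alloc_minus x t" "\<And>t. 0 \<le> q t \<and> q t \<le> 1"
      "(\<integral>s. x s i \<partial>PiM {..<n} (\<lambda>_. FM)) = (\<integral>t. q t \<partial>FM)"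
    unfolding J(4) alloc_minus_def by auto
  show "t \<in> {a..b} \<Longrightarrow> alloc_plus x t \<in> {0..1}" "t \<in> {a..b} \<Longrightarrow> alloc_minus x t \<in> {0..1}"
    using p(2,3)[of t] q(2,3)[of t] by auto
  have ip: "integrable lborel (\<lambda>t. dens_plus t * p t)"
  proof -
    have "integrable FP p" using p by (intro FP.integrable_const_bound[where B = 1]) auto
    thus ?thesis unfolding FP_eq using p(1) by (simp add: integrable_density dens_plus_nonneg)
  qed
  have iq: "integrable lborel (\<lambda>t. dens_minus t * q t)"
  proof -
    have "integrable FM q" using q by (intro FM.integrable_const_bound[where B = 1]) auto
    thus ?thesis unfolding FM_eq using q(1) by (simp add: integrable_density dens_minus_nonneg)
  qed
  \<comment> \<open>The prior 1/2 cancels the factor 2 of the conditional densities.\<close>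
  have eq: "indicator {a..b} t *\<^sub>R (f t * (t * alloc_plus x t + (1 - t) * alloc_minus x t)) = (dens_plus t * p t) / 2 + (dens_minus t * q t) / 2" for t
    using p(2)[of t] q(2)[of t] by (cases "t \<in> {a..b}") (auto simp: dens_plus_def dens_minus_def field_simps)
  show "set_integrable lborel {a..b} (\<lambda>t. f t * (t * alloc_plus x t + (1 - t) * alloc_minus x t))"
    unfolding set_integrable_def eq using ip iq by simp
  have "(\<integral>t. p t \<partial>FP) = (\<integral>t. dens_plus t * p t \<partial>lborel)" "(\<integral>t. q t \<partial>FM) = (\<integral>t. dens_minus t * q t \<partial>lborel)"
    unfolding FP_eq FM_eq using p(1) q(1) by (simp_all add: integral_density dens_plus_nonneg dens_minus_nonneg)
  thus "ex_alloc a b f n x i = (LBINT t:{a..b}. f t * (t * alloc_plus x t + (1 - t) * alloc_minus x t))"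
    unfolding ex_alloc_def p(4) q(4) set_lebesgue_integral_def eq using ip iq by simp
qed

text \<open>Offering the option "always" in addition, i.e. the line \<open>2 * v - 1\<close>, only raises the allocation,
  since a type that switches to it receives the good with probability one.\<close>
lemma feasible_dominated:
  assumes x: "is_mechanism a b n x" and fe: "feasible a b f n x i"
  shows "\<exists>W\<in>G. ex_alloc a b f n x i \<le> welfare W"
proof -
  define l where "l t v = v * alloc_plus x t - (1 - v) * alloc_minus x t" for t v
  define U where "U s = l s s" for s
  define m where "m s = alloc_plus x s + alloc_minus x s" for s
  define U' where "U' s = max (U s) (2 * s - 1)" for s
  define m' where "m' s = (if 2 * s - 1 \<le> U s then m s else 2)" for s
  have P: "0 \<le> U u" if "u \<in> {a..b}" for u
    using fe that by (simp add: feasible_def interim_eq U_def l_def)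
  have IC: "l t u \<le> U u" if "u \<in> {a..b}" "t \<in> {a..b}" for u t
    using fe that by (simp add: feasible_def interim_eq U_def l_def)
  have lm: "l t u = U t + m t * (u - t)" for t u
    by (simp add: l_def U_def m_def algebra_simps)
  \<comment> \<open>Incentive compatibility is the subgradient inequality for \<open>U\<close>;
    passing to the larger of \<open>U\<close> and a line of slope 2 preserves it.\<close>
  have sg: "subgrad_on {a..b} U' m'"
    unfolding subgrad_on_def
  proof (intro ballI)
    fix s t assume st: "s \<in> {a..b}" "t \<in> {a..b}"
    show "U' s + m' s * (t - s) \<le> U' t"
      using IC[OF st(2,1)] lm[of s t] by (auto simp: U'_def m'_def max_def algebra_simps)
  qed
  have m2: "\<bar>m' s\<bar> \<le> 2" if "s \<in> {a..b}" for s
    using ex_alloc_eq(3,4)[OF x that] by (auto simp: m'_def m_def)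
  have "ex_alloc a b f n x i = (LBINT t:{a..b}. f t * (t * alloc_plus x t + (1 - t) * alloc_minus x t))"
    by (rule ex_alloc_eq(2)[OF x])
  also have "\<dots> \<le> (LBINT s:{a..b}. f s * (s * (U' s + (1 - s) * m' s) + (1 - s) * (s * m' s - U' s)))"
  proof (rule set_integral_mono[OF ex_alloc_eq(1)[OF x] welfare_by_parts(1)[OF sg m2]])
    fix s assume s: "s \<in> {a..b}"
    have "s * alloc_plus x s + (1 - s) * alloc_minus x s \<le> s * (U' s + (1 - s) * m' s) + (1 - s) * (s * m' s - U' s)"
    proof (cases "2 * s - 1 \<le> U s")
      case True
      hence "U' s = U s" "m' s = m s" by (simp_all add: U'_def m'_def)
      moreover have "U s + (1 - s) * m s = alloc_plus x s" "s * m s - U s = alloc_minus x s"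
        by (simp_all add: U_def m_def l_def algebra_simps)
      ultimately show ?thesis by simp
    next
      case False
      hence eq: "U' s = 2 * s - 1" "m' s = 2" by (simp_all add: U'_def m'_def)
      have "s * (U' s + (1 - s) * m' s) + (1 - s) * (s * m' s - U' s) = s * 1 + (1 - s) * 1"
        unfolding eq by (simp add: algebra_simps)
      moreover have "s * alloc_plus x s + (1 - s) * alloc_minus x s \<le> s * 1 + (1 - s) * 1"
        using ex_alloc_eq(3,4)[OF x s] s ab by (intro add_mono mult_left_mono) auto
      ultimately show ?thesis by simp
    qed
    thus "f s * (s * alloc_plus x s + (1 - s) * alloc_minus x s) \<le> f s * (s * (U' s + (1 - s) * m' s) + (1 - s) * (s * m' s - U' s))"
      using fpos s by (intro mult_left_mono) (auto intro: less_imp_le)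
  qed
  also have "\<dots> = welfare U'" by (rule welfare_by_parts(2)[OF sg m2])
  finally have le: "ex_alloc a b f n x i \<le> welfare U'" .
  \<comment> \<open>So far \<open>U'\<close> is convex on \<open>[a, b]\<close> only. The envelope
    of all offered lines together with 0 and \<open>2 * v - 1\<close> extends it convexly to
    \<open>[0, 1]\<close>, and \<open>neyman_pearson\<close> and \<open>V_lower\<close> keep it
    below \<open>V\<close>.\<close>
  define W where "W v = max (max 0 (2 * v - 1)) (SUP t\<in>{a..b}. l t v)" for v
  have ne: "{a..b} \<noteq> {}" using ab by simp
  have lV: "l t v \<le> V v" if "t \<in> {a..b}" "v \<in> {0..1}" for t v
    using neyman_pearson[OF mechanism_slice[OF x that(1)], of v] that(2)
    by (simp add: l_def alloc_plus_def alloc_minus_def V_def)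
  have bdd: "bdd_above ((\<lambda>t. l t v) ` {a..b})" if "v \<in> {0..1}" for v
    by (rule bdd_aboveI2[where M = "V v"]) (use lV that in auto)
  have lW: "l t v \<le> W v" if "t \<in> {a..b}" "v \<in> {0..1}" for t v
    unfolding W_def using cSUP_upper[OF that(1) bdd[OF that(2)]] by simp
  have WU: "W s = U' s" if s: "s \<in> {a..b}" for s
  proof -
    have "(SUP t\<in>{a..b}. l t s) = U s"
      by (rule cSup_eq_maximum) (use IC[OF s] s in \<open>auto simp: U_def\<close>)
    thus ?thesis using P[OF s] by (simp add: W_def U'_def max_def)
  qed
  have "W \<in> G" unfolding G_def
  proof (intro CollectI conjI ballI)
    show "convex_on {0..1} W"
    proof (rule convex_onI)
      fix t x y :: real assume t: "0 < t" "t < 1" and xy: "x \<in> {0..1}" "y \<in> {0..1}"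
      define z where "z = (1 - t) * x + t * y"
      have cm: "(1 - t) * u + t * v \<le> (1 - t) * W x + t * W y" if "u \<le> W x" "v \<le> W y" for u v
        using that t by (intro add_mono mult_left_mono) auto
      have "0 \<le> (1 - t) * W x + t * W y"
        using cm[of 0 0] by (simp add: W_def)
      moreover have "2 * z - 1 \<le> (1 - t) * W x + t * W y"
        using cm[of "2 * x - 1" "2 * y - 1"] by (simp add: W_def z_def algebra_simps)
      moreover have "(SUP s\<in>{a..b}. l s z) \<le> (1 - t) * W x + t * W y"
      proof (rule cSUP_least[OF ne])
        fix s assume s: "s \<in> {a..b}"
        have "l s z = (1 - t) * l s x + t * l s y"
          by (simp add: l_def z_def algebra_simps)
        also have "\<dots> \<le> (1 - t) * W x + t * W y" using s xy by (intro cm lW)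
        finally show "l s z \<le> (1 - t) * W x + t * W y" .
      qed
      ultimately show "W ((1 - t) *\<^sub>R x + t *\<^sub>R y) \<le> (1 - t) * W x + t * W y"
        by (simp add: W_def[of z] z_def[symmetric])
    qed simp
    fix v :: real assume v: "v \<in> {0..1}"
    show "0 \<le> W v" "2 * v - 1 \<le> W v" by (simp_all add: W_def)
    have "(SUP t\<in>{a..b}. l t v) \<le> V v" using lV v by (intro cSUP_least[OF ne])
    thus "W v \<le> V v" using V_lower[OF v] by (simp add: W_def)
  qed
  moreover have "welfare W = welfare U'"
  proof -
    have "integral {a..b} (\<lambda>s. util_weight s * W s) = integral {a..b} (\<lambda>s. util_weight s * U' s)"
      by (intro Henstock_Kurzweil_Integration.integral_cong) (simp add: WU)
    thus ?thesis using ab by (simp add: welfare_def WU)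
  qed
  ultimately show ?thesis using le by (intro bexI[of _ W]) auto
qed

end

section \<open>The optimal mechanism\<close>

context screening begin

lemma tangent_le:
  assumes "U \<in> G" "s \<in> {0..1}" "v \<in> {0..1}"
  shows "tangent U s v \<le> V v"
  using subgrad_onD[OF subgrad_rderiv[OF assms(1)] assms(2,3)] GD(4)[OF assms(1,3)]
  by (simp add: tangent_def)

lemma tangent_eq_item:
  "tangent U s v = v * (U s + (1 - s) * rderiv U s) - (1 - v) * (s * rderiv U s - U s)"
  by (simp add: tangent_def algebra_simps)

text \<open>The bought line takes the value \<open>- q\<close> at 0, \<open>p\<close> at 1 and
  \<open>(p - q) / 2\<close> at 1/2. The first two are at most \<open>U 0 = 0\<close> and
  \<open>U 1 = 1\<close>. The third is nonnegative: for \<open>s \<le> 1 / 2\<close> because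
  \<open>U\<close> and the slope are, otherwise because the slope is at most 2 and
  \<open>2 * s - 1 \<le> U s\<close>.\<close>

lemma item_bounds:
  assumes U: "U \<in> G" and s: "s \<in> {0..1}"
  shows "0 \<le> s * rderiv U s - U s"
    "s * rderiv U s - U s \<le> U s + (1 - s) * rderiv U s" "U s + (1 - s) * rderiv U s \<le> 1"
proof -
  note sg = subgrad_onD[OF subgrad_rderiv[OF U] s]
  show "0 \<le> s * rderiv U s - U s" using sg[of 0] GD(5)[OF U] by (simp add: algebra_simps)
  show "U s + (1 - s) * rderiv U s \<le> 1" using sg[of 1] GD(6)[OF U] by (simp add: algebra_simps)
  have "0 \<le> 2 * U s + (1 - 2 * s) * rderiv U s"
  proof (cases "s \<le> 1 / 2")
    case True
    thus ?thesis using GD(2)[OF U s] rderiv_bounds[OF U s] by (intro add_nonneg_nonneg mult_nonneg_nonneg) auto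
  next
    case False
    hence "(2 * s - 1) * rderiv U s \<le> (2 * s - 1) * 2"
      using rderiv_bounds[OF U s] by (intro mult_left_mono) auto
    thus ?thesis using GD(3)[OF U s] by (simp add: algebra_simps)
  qed
  thus "s * rderiv U s - U s \<le> U s + (1 - s) * rderiv U s" by (simp add: algebra_simps)
qed

lemma same_slope_same_item:
  assumes U: "U \<in> G" and st: "s \<in> {0..1}" "t \<in> {0..1}" and eq: "rderiv U s = rderiv U t"
  shows "U s + (1 - s) * rderiv U s = U t + (1 - t) * rderiv U t"
    "s * rderiv U s - U s = t * rderiv U t - U t" "tangent U s = tangent U t"
proof -
  note 1 = rderiv_eq_line[OF U st eq]
  show "U s + (1 - s) * rderiv U s = U t + (1 - t) * rderiv U t" unfolding 1 eq[symmetric] by (simp add: algebra_simps)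
  show "s * rderiv U s - U s = t * rderiv U t - U t" unfolding 1 eq[symmetric] by (simp add: algebra_simps)
  show "tangent U s = tangent U t" unfolding tangent_def 1 eq[symmetric] by (simp add: fun_eq_iff algebra_simps)
qed

lemma rational_slope:
  assumes U: "U \<in> G" and st: "s \<in> {0..1}" "t \<in> {0..1}" "s < t" and eq: "rderiv U s = rderiv U t"
  shows "rderiv U s \<in> rderiv U ` (\<rat> \<inter> {0..1})"
proof -
  obtain r where r: "r \<in> \<rat>" "s < r" "r < t" using Rats_dense_in_real[OF st(3)] by blast
  hence "rderiv U s \<le> rderiv U r" "rderiv U r \<le> rderiv U t"
    using st by (auto intro!: mono_onD[OF rderiv_mono[OF U]])
  with eq r st show ?thesis by (intro image_eqI[of _ _ r]) auto
qed

text \<open>0 and 1 are rational, so \<open>s\<close> is interior. If \<open>U s < V s\<close>, then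
  \<open>extremal_right_affine\<close> would extend the piece to the right of \<open>s\<close> and a
  rational type would share its slope. Hence the line of \<open>s\<close> touches \<open>V\<close>
  at \<open>s\<close>, and \<open>touching_line\<close> identifies the item.\<close>

lemma irrational_slope:
  assumes ex: "extremal U" and s: "s \<in> {0..1}" and irr: "rderiv U s \<notin> rderiv U ` (\<rat> \<inter> {0..1})"
  shows "0 < s" "s < 1" "U s + (1 - s) * rderiv U s = A s" "s * rderiv U s - U s = B s"
    "t \<in> {0..1} \<Longrightarrow> rderiv U t = rderiv U s \<Longrightarrow> t = s"
proof -
  have U: "U \<in> G" using ex by (simp add: extremal_def)
  have "s \<notin> \<rat>" using irr s by blast
  hence "s \<noteq> 0" "s \<noteq> 1" by auto
  thus s01: "0 < s" "s < 1" using s by auto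
  have "U s = V s"
  proof (rule ccontr)
    assume "U s \<noteq> V s"
    hence "U s < V s" using GD(4)[OF U s] by simp
    then obtain t where "s < t" "t \<le> 1" "rderiv U t = rderiv U s"
      using extremal_right_affine[OF ex s01] by blast
    thus False using rational_slope[OF U s, of t] irr s by auto
  qed
  hence "s * (U s + (1 - s) * rderiv U s) - (1 - s) * (s * rderiv U s - U s) = V s"
    unfolding tangent_eq_item[symmetric] by (simp add: tangent_def)
  from touching_line[OF item_bounds[OF U s] tangent_le[OF U s, unfolded tangent_eq_item] s this]
  show "U s + (1 - s) * rderiv U s = A s" "s * rderiv U s - U s = B s" by auto
  show "t = s" if "t \<in> {0..1}" "rderiv U t = rderiv U s"
    using rational_slope[OF U s that(1)] rational_slope[OF U that(1) s] irr that(2)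
    by (metis linorder_neqE_linordered_idom)
qed

end

lemma first_best_iff:
  fixes L :: ereal
  assumes u: "0 < u" "u < 1" and L: "0 \<le> L"
  shows "1 \<le> lr u * L \<longleftrightarrow> inverse (lr u) \<le> L"
proof (cases L)
  case (real r)
  with u L show ?thesis by (simp add: lr_pos field_simps one_ereal_def)
next
  case PInf
  with u show ?thesis by (simp add: lr_pos)
next
  case MInf
  with L show ?thesis by simp
qed

lemma LRset_nonneg:
  assumes "\<And>k. k \<in> K \<Longrightarrow> 0 \<le> y k \<and> y k \<le> 1"
  shows "0 \<le> LRset y K"
  unfolding LRset_def
proof (rule prod_ereal_pos)
  fix k assume "k \<in> K"
  thus "0 \<le> lr (y k)" using assms[of k] by (simp add: lr_def)
qed

lemma admissible_tau_inverse_lr: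
  assumes "0 < \<theta>" "\<theta> \<le> 1"
  shows "admissible_tau S (inverse (lr \<theta>))"
  using assms by (cases "\<theta> = 1") (auto simp: admissible_tau_def lr_def)

context signals begin

section \<open>Assembling the mechanism of one agent\<close>

lemma ab_sub: "t \<in> {a..b} \<Longrightarrow> t \<in> {0..1}"
  using ab by auto

lemma LRset_upd: "LRset (y(i := u)) J = LRset y J" "LRset (y(i := u)) {..<n} = lr u * LRset y J"
proof -
  show 1: "LRset (y(i := u)) J = LRset y J"
    unfolding LRset_def using J(3) by (intro prod.cong) auto
  have "LRset (y(i := u)) {..<n} = lr u * LRset (y(i := u)) J"
    unfolding J(4)[symmetric] LRset_def using prod.insert[OF J(1,3), of "\<lambda>k. lr ((y(i := u)) k)"] by (simp only: fun_upd_same)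
  thus "LRset (y(i := u)) {..<n} = lr u * LRset y J" by (simp add: 1)
qed

lemma optimal_mechanism:
  "\<exists>x P T. optimal_for a b f n i x \<and> monotone_threshold a b n x i P \<and>
     T \<subseteq> P \<and> countable T \<and>
     (\<forall>S\<in>P - T. \<forall>u\<in>S. \<forall>y\<in>others_box a b n i.
        x (y(i := u)) i = (if LRset (y(i := u)) {..<n} \<ge> 1 then 1 else 0)) \<and>
     (\<forall>S\<in>T. \<forall>S'\<in>T. adjacent S S' \<longrightarrow>
        deterministic_threshold_on a b n x i S \<or> deterministic_threshold_on a b n x i S')"
proof -
  have "\<exists>U. extremal U \<and> (\<forall>W\<in>G. welfare W \<le> welfare U)"
    unfolding welfare_def using ab by (intro extremal_maximizer_exists cont_util_weight) auto
  then obtain U where ex: "extremal U" and max: "\<And>W. W \<in> G \<Longrightarrow> welfare W \<le> welfare U" by blast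
  have U: "U \<in> G" using ex by (simp add: extremal_def)
  define D where "D = rderiv U"
  define C where "C = D ` (\<rat> \<inter> {0..1})"
  define p where "p s = U s + (1 - s) * D s" for s
  define q where "q s = s * D s - U s" for s
  have sg: "subgrad_on {0..1} U D" unfolding D_def by (rule subgrad_rderiv[OF U])
  have mono: "mono_on {0..1} D" by (rule subgrad_on_mono[OF sg])
  have countC: "countable C" unfolding C_def by (intro countable_image countable_Int1 countable_rat)
  \<comment> \<open>One threshold is chosen per slope rather than per type, read off from a rational
    representative; so all reports in a level set receive the same rule.\<close>
  have "\<forall>c\<in>C. \<exists>z. fst z \<in> {0..1} \<and> snd z \<in> {0<..1} \<and> (\<forall>s\<in>{0..1}. D s = c \<longrightarrow>
          p s = fst z * A (snd z) \<and> q s = fst z * B (snd z) \<and>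
          ((\<exists>v\<in>{0..1}. tangent U s v = V v) \<longrightarrow> fst z \<in> {0, 1}))"
  proof
    fix c assume "c \<in> C"
    then obtain r where r: "r \<in> {0..1}" "D r = c" by (auto simp: C_def)
    from item_as_threshold_touching[OF item_bounds[OF U r(1)] tangent_le[OF U r(1), unfolded tangent_eq_item]]
    obtain \<kappa> \<theta> where "\<kappa> \<in> {0..1}" "\<theta> \<in> {0<..1}" "p r = \<kappa> * A \<theta>" "q r = \<kappa> * B \<theta>"
      "(\<exists>v\<in>{0..1}. tangent U r v = V v) \<longrightarrow> \<kappa> \<in> {0, 1}"
      unfolding tangent_eq_item p_def q_def D_def by blast
    moreover have "p s = p r" "q s = q r" "tangent U s = tangent U r" if "s \<in> {0..1}" "D s = c" for s
      using same_slope_same_item[OF U that(1) r(1)] that(2) r(2) by (simp_all add: p_def q_def D_def)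
    ultimately show "\<exists>z. fst z \<in> {0..1} \<and> snd z \<in> {0<..1} \<and> (\<forall>s\<in>{0..1}. D s = c \<longrightarrow>
          p s = fst z * A (snd z) \<and> q s = fst z * B (snd z) \<and>
          ((\<exists>v\<in>{0..1}. tangent U s v = V v) \<longrightarrow> fst z \<in> {0, 1}))"
      by (intro exI[of _ "(\<kappa>, \<theta>)"]) auto
  qed
  from bchoice[OF this] obtain z where z: "\<And>c. c \<in> C \<Longrightarrow> fst (z c) \<in> {0..1} \<and> snd (z c) \<in> {0<..1} \<and>
      (\<forall>s\<in>{0..1}. D s = c \<longrightarrow> p s = fst (z c) * A (snd (z c)) \<and> q s = fst (z c) * B (snd (z c)) \<and>
          ((\<exists>v\<in>{0..1}. tangent U s v = V v) \<longrightarrow> fst (z c) \<in> {0, 1}))" by blast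
  define \<kappa> where "\<kappa> c = fst (z c)" for c
  define \<tau> where "\<tau> c = inverse (lr (snd (z c)))" for c
  have \<kappa>01: "\<kappa> c \<in> {0..1}" and \<tau>: "admissible_tau S (\<tau> c)" if "c \<in> C" for c S
    using z[OF that] admissible_tau_inverse_lr by (auto simp: \<kappa>_def \<tau>_def)
  define L where "L c = {s\<in>{a..b}. D s = c}" for c
  \<comment> \<open>Optimality concerns agent \<open>i\<close> only, so the other components are set
    to zero.\<close>
  define x :: "(nat \<Rightarrow> real) \<Rightarrow> nat \<Rightarrow> real" where
    "x s j = (if j \<noteq> i then 0
       else if \<exists>c\<in>C. s i \<in> L c then \<kappa> (D (s i)) * (if \<tau> (D (s i)) \<le> LRset s J then 1 else 0)
       else if 1 \<le> LRset s {..<n} then 1 else 0)" for s j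
  have xC: "x (y(i := u)) i = \<kappa> (D u) * (if \<tau> (D u) \<le> LRset y J then 1 else 0)" if "u \<in> {a..b}" "D u \<in> C" for y u
    using that by (auto simp: x_def LRset_upd L_def)
  have xnC: "x (y(i := u)) i = (if 1 \<le> LRset (y(i := u)) {..<n} then 1 else 0)" if "D u \<notin> C" for y u
    using that by (auto simp: x_def L_def)
  have Linterval: "is_interval (L c)" for c
    unfolding is_interval_1
  proof (intro ballI allI impI)
    fix s t r assume st: "s \<in> L c" "t \<in> L c" and r: "s \<le> r \<and> r \<le> t"
    hence "s \<in> {0..1}" "t \<in> {0..1}" "r \<in> {0..1}" using ab_sub by (auto simp: L_def)
    hence "D s \<le> D r" "D r \<le> D t" using r mono_onD[OF mono] by blast+
    hence "D r = c" using st by (simp add: L_def)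
    thus "r \<in> L c" using st r by (auto simp: L_def)
  qed
  have Lborel: "L c \<in> sets borel" for c
    by (rule real_interval_borel_measurable[OF Linterval])
  have irr: "0 < u" "u < 1" "p u = A u" "q u = B u" "L (D u) = {u}" if "u \<in> {a..b}" "D u \<notin> C" for u
    using irrational_slope[OF ex ab_sub[OF that(1)]] that ab_sub
    by (auto simp: p_def q_def D_def C_def L_def)
  have tn: "1 \<le> LRset (y(i := u)) {..<n} \<longleftrightarrow> inverse (lr u) \<le> LRset y J"
    if "u \<in> {a..b}" "D u \<notin> C" "\<And>k. k \<in> J \<Longrightarrow> y k \<in> {a..b}" for u y
    unfolding LRset_upd using irr[OF that(1,2)] that(3) ab
    by (intro first_best_iff LRset_nonneg) force+
  have "is_mechanism a b n x"
    unfolding is_mechanism_def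
  proof (intro conjI allI ballI impI)
    fix j assume "j < n"
    let ?M = "PiM {..<n} (\<lambda>_. lborel :: real measure)"
    have ci: "(\<lambda>s. s i) \<in> ?M \<rightarrow>\<^sub>M borel"
      using measurable_component_singleton[of i "{..<n}" "\<lambda>_. lborel"] i by simp
    have pre: "{s \<in> space ?M. s i \<in> L c} \<in> sets ?M" for c
      using measurable_sets[OF ci Lborel] by (simp add: vimage_def Int_def conj_commute)
    have mLJ: "(\<lambda>s. LRset s J) \<in> borel_measurable ?M" by (rule borel_measurable_LRset) (auto simp: J_def)
    have mLn: "(\<lambda>s. LRset s {..<n}) \<in> borel_measurable ?M" by (rule borel_measurable_LRset) simp
    have "(\<lambda>s. x s i) \<in> borel_measurable ?M"
    \<comment> \<open>Countably many measurable pieces: one fixed threshold on each level set with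
      slope in \<open>C\<close>, and the first-best rule on the remainder.\<close>
    proof (rule measurable_piecewise_restrict[where C = "insert {s. \<not> (\<exists>c\<in>C. s i \<in> L c)} ((\<lambda>c. {s. s i \<in> L c}) ` C)"])
      show "countable (insert {s. \<not> (\<exists>c\<in>C. s i \<in> L c)} ((\<lambda>c. {s. s i \<in> L c}) ` C))"
        using countC by simp
      show "space ?M \<subseteq> \<Union> (insert {s. \<not> (\<exists>c\<in>C. s i \<in> L c)} ((\<lambda>c. {s. s i \<in> L c}) ` C))" by auto
      fix \<Omega> assume \<Omega>: "\<Omega> \<in> insert {s. \<not> (\<exists>c\<in>C. s i \<in> L c)} ((\<lambda>c. {s. s i \<in> L c}) ` C)"
      show "\<Omega> \<inter> space ?M \<in> sets ?M"
      proof (cases "\<Omega> = {s. \<not> (\<exists>c\<in>C. s i \<in> L c)}")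
        case True
        have "(\<Union>c\<in>C. {s \<in> space ?M. s i \<in> L c}) \<in> sets ?M"
          using countC pre by (intro sets.countable_UN') auto
        moreover have "\<Omega> \<inter> space ?M = space ?M - (\<Union>c\<in>C. {s \<in> space ?M. s i \<in> L c})"
          using True by auto
        ultimately show ?thesis by auto
      next
        case False
        then obtain c where "\<Omega> = {s. s i \<in> L c}" using \<Omega> by auto
        thus ?thesis using pre[of c] by (simp add: Int_def conj_commute)
      qed
      show "(\<lambda>s. x s i) \<in> borel_measurable (restrict_space ?M \<Omega>)"
      proof (cases "\<Omega> = {s. \<not> (\<exists>c\<in>C. s i \<in> L c)}")
        case True
        have "(\<lambda>s. if 1 \<le> LRset s {..<n} then 1 else 0 :: real) \<in> borel_measurable ?M"
          using mLn by measurable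
        from measurable_restrict_space1[OF this, of \<Omega>] show ?thesis
          by (rule measurable_cong[THEN iffD1, rotated]) (auto simp: space_restrict_space True x_def)
      next
        case False
        then obtain c where c: "c \<in> C" "\<Omega> = {s. s i \<in> L c}" using \<Omega> by auto
        have "(\<lambda>s. \<kappa> c * (if \<tau> c \<le> LRset s J then 1 else 0 :: real)) \<in> borel_measurable ?M"
          using mLJ by measurable
        from measurable_restrict_space1[OF this, of \<Omega>] show ?thesis
          by (rule measurable_cong[THEN iffD1, rotated]) (use c in \<open>auto simp: space_restrict_space x_def L_def\<close>)
      qed
    qed
    thus "(\<lambda>s. x s j) \<in> borel_measurable ?M"
      by (cases "j = i") (auto simp: x_def)
  next
    fix s j
    show "x s j \<in> {0..1}"
      using \<kappa>01 by (auto simp: x_def L_def)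
  qed
  note mech = this
  have prx: "alloc_plus x t = p t" and qrx: "alloc_minus x t = q t" if t: "t \<in> {a..b}" for t
  proof -
    have "alloc_plus x t = p t \<and> alloc_minus x t = q t"
    proof (cases "D t \<in> C")
      case True
      note item = z[OF True]
      have "alloc_plus x t = \<kappa> (D t) * A (snd (z (D t)))" "alloc_minus x t = \<kappa> (D t) * B (snd (z (D t)))"
        unfolding alloc_plus_def alloc_minus_def xC[OF t True] integral_mult_right_zero \<tau>_def
        using item threshold_integral[of "snd (z (D t))"] by simp_all
      thus ?thesis using item ab_sub[OF t] by (simp add: \<kappa>_def)
    next
      case False
      have box: "x (y(i := t)) i = (if inverse (lr t) \<le> LRset y J then 1 else 0)" if "inbox y" for y
        using tn[OF t False, of y] that by (simp add: xnC[OF False] inbox_def)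
      have mI: "(\<lambda>y. if inverse (lr t) \<le> LRset y J then 1 else 0 :: real) \<in> borel_measurable N" by measurable
      have "alloc_plus x t = A t"
        unfolding alloc_plus_def threshold_integral(1)[OF less_imp_le[OF irr(1)[OF t False]] less_imp_le[OF irr(2)[OF t False]], symmetric]
      proof (rule integral_cong_AE)
        show "AE y in PP. x (y(i := t)) i = (if inverse (lr t) \<le> LRset y J then 1 else 0)"
          using AE_inbox(1) by eventually_elim (rule box)
      qed (use mechanism_slice(1)[OF mech t] mI in \<open>simp_all add: measurable_cong_sets[OF sets_P(1) refl]\<close>)
      moreover have "alloc_minus x t = B t"
        unfolding alloc_minus_def threshold_integral(2)[OF less_imp_le[OF irr(1)[OF t False]] less_imp_le[OF irr(2)[OF t False]], symmetric]
      proof (rule integral_cong_AE)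
        show "AE y in PM. x (y(i := t)) i = (if inverse (lr t) \<le> LRset y J then 1 else 0)"
          using AE_inbox(2) by eventually_elim (rule box)
      qed (use mechanism_slice(1)[OF mech t] mI in \<open>simp_all add: measurable_cong_sets[OF sets_P(2) refl]\<close>)
      ultimately show ?thesis using irr[OF t False] by simp
    qed
    thus "alloc_plus x t = p t" "alloc_minus x t = q t" by auto
  qed
  \<comment> \<open>A report \<open>t\<close> gives type \<open>u\<close> the value at
    \<open>u\<close> of the supporting line at \<open>t\<close>, so incentive compatibility is again
    the subgradient inequality.\<close>
  have util: "interim_util a b f n x i u t = U t + D t * (u - t)" if "t \<in> {a..b}" for u t
    unfolding interim_eq prx[OF that] qrx[OF that] by (simp add: p_def q_def algebra_simps)
  have feas: "feasible a b f n x i"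
    unfolding feasible_def
  proof (intro conjI ballI)
    fix u assume u: "u \<in> {a..b}"
    show "0 \<le> interim_util a b f n x i u u" using util[OF u] GD(2)[OF U ab_sub[OF u]] by simp
    fix t assume t: "t \<in> {a..b}"
    show "interim_util a b f n x i u t \<le> interim_util a b f n x i u u"
      using util[OF u] util[OF t] subgrad_onD[OF sg ab_sub[OF t] ab_sub[OF u]] by simp
  qed
  have "ex_alloc a b f n x i = welfare U"
  proof -
    have "ex_alloc a b f n x i = (LBINT t:{a..b}. f t * (t * p t + (1 - t) * q t))"
      unfolding ex_alloc_eq(2)[OF mech] by (rule set_lebesgue_integral_cong) (auto simp: prx qrx)
    also have "\<dots> = welfare U"
      unfolding p_def q_def
      using rderiv_bounds[OF U ab_sub] ab_sub
      by (intro welfare_by_parts(2) subgrad_on_subset[OF sg]) (auto simp: D_def)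
    finally show ?thesis .
  qed
  hence opt: "optimal_for a b f n i x"
    unfolding optimal_for_def using mech feas feasible_dominated max by fastforce
  define P where "P = (\<lambda>u. L (D u)) ` {a..b}"
  define T where "T = P \<inter> L ` C"
  have tfC: "threshold_form a b n x i (L c) (\<kappa> c) (\<tau> c)" if "c \<in> C" for c
    unfolding threshold_form_def J_def[symmetric]
  proof (intro ballI)
    fix u y assume "u \<in> L c"
    thus "x (y(i := u)) i = \<kappa> c * (if \<tau> c \<le> LRset y J then 1 else 0)"
      using xC[of u y] that by (simp add: L_def)
  qed
  have "monotone_threshold a b n x i P"
    unfolding monotone_threshold_def
  proof (intro conjI ballI)
    show "interval_partition a b P"
      unfolding interval_partition_def
    proof (intro conjI ballI)
      show "pairwise disjnt P" by (auto simp: pairwise_def disjnt_def P_def L_def)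
      show "\<Union>P = {a..b}" by (auto simp: P_def L_def)
    qed (use Linterval in \<open>auto simp: P_def L_def\<close>)
    fix S assume "S \<in> P"
    then obtain u where u: "u \<in> {a..b}" "S = L (D u)" by (auto simp: P_def)
    show "\<exists>\<kappa>\<in>{0..1}. \<exists>\<tau>. admissible_tau S \<tau> \<and> threshold_form a b n x i S \<kappa> \<tau>"
    proof (cases "D u \<in> C")
      case True
      thus ?thesis using \<kappa>01 \<tau> tfC u(2) by blast
    next
      case False
      have "threshold_form a b n x i {u} 1 (inverse (lr u))"
        unfolding threshold_form_def J_def[symmetric] others_box_eq
        using tn[OF u(1) False] by (auto simp: xnC[OF False] PiE_iff)
      moreover have "admissible_tau S (inverse (lr u))"
        using irr[OF u(1) False] by (intro admissible_tau_inverse_lr) auto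
      ultimately show ?thesis using irr(5)[OF u(1) False] u(2) by (intro bexI[of _ 1] exI) auto
    qed
  qed
  moreover have "countable T" unfolding T_def using countC by (intro countable_Int2) auto
  moreover have "x (y(i := u)) i = (if LRset (y(i := u)) {..<n} \<ge> 1 then 1 else 0)"
    if "S \<in> P - T" "u \<in> S" for S u y
  proof -
    have "D u \<notin> C" using that by (auto simp: P_def T_def L_def)
    thus ?thesis by (rule xnC)
  qed
  moreover have "deterministic_threshold_on a b n x i S \<or> deterministic_threshold_on a b n x i S'"
    if ST: "S \<in> T" "S' \<in> T" and adj: "adjacent S S'" for S S'
  proof (rule ccontr)
    assume nd: "\<not> ?thesis"
    \<comment> \<open>A factor outside \<open>{0, 1}\<close> means that the line of that slope does
      not touch \<open>V\<close>. Being below \<open>V\<close>, it is then strictly below on all of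
      \<open>[0, 1]\<close>, and \<open>extremal_adjacent_pieces\<close> excludes two such
      neighbours.\<close>
    have main: False if cc: "c \<in> C" "c' \<in> C" "c < c'" and ne: "L c \<noteq> {}" "L c' \<noteq> {}" and int: "is_interval (L c \<union> L c')"
      and nd: "\<kappa> c \<notin> {0, 1}" "\<kappa> c' \<notin> {0, 1}" for c c'
    proof -
      obtain u u' where u: "u \<in> {a..b}" "D u = c" and u': "u' \<in> {a..b}" "D u' = c'"
        using ne by (auto simp: L_def)
      have "u < u'" using mono_onD[OF mono, of u' u] u u' cc ab_sub by (force simp: not_less)
      have strict: "tangent U s v < V v" if "s \<in> {a..b}" "D s \<in> C" "\<kappa> (D s) \<notin> {0, 1}" "v \<in> {0..1}" for s v
        using z[OF that(2)] that ab_sub[OF that(1)] tangent_le[OF U ab_sub[OF that(1)] that(4)]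
        by (force simp: \<kappa>_def)
      show False
      proof (rule extremal_adjacent_pieces[OF ex _ \<open>u < u'\<close>])
        \<comment> \<open>Because the union of the two level sets is an interval, no third slope
          occurs between \<open>u\<close> and \<open>u'\<close>.\<close>
        show "rderiv U s = rderiv U u \<or> rderiv U s = rderiv U u'" if "s \<in> {u..u'}" for s
        proof -
          have "u \<in> L c \<union> L c'" "u' \<in> L c \<union> L c'" using u u' by (auto simp: L_def)
          hence "s \<in> L c \<union> L c'" using mem_is_interval_1_I[OF int] that by (meson atLeastAtMost_iff)
          thus ?thesis using u u' by (auto simp: L_def D_def)
        qed
      qed (use u u' cc ab nd strict in \<open>auto simp: D_def\<close>)
    qed
    obtain c c' where c: "c \<in> C" "S = L c" "c' \<in> C" "S' = L c'" using ST by (auto simp: T_def)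
    have "\<kappa> c \<notin> {0, 1}" "\<kappa> c' \<notin> {0, 1}"
      using nd c \<tau> tfC unfolding deterministic_threshold_on_def by blast+
    moreover have "L c \<noteq> {}" "L c' \<noteq> {}" using ST c by (auto simp: T_def P_def L_def)
    moreover have "c \<noteq> c'" "is_interval (L c \<union> L c')" "is_interval (L c' \<union> L c)"
      using adj c by (auto simp: adjacent_def Un_commute)
    ultimately show False using main[of c c'] main[of c' c] c by linarith
  qed
  ultimately show ?thesis using opt by (intro exI[of _ x] exI[of _ P] exI[of _ T]) (auto simp: T_def)
qed

end

theorem theoremA1:
  fixes n :: nat and a b :: real and f f' :: "real \<Rightarrow> real"
  assumes "n \<ge> 2"
    and "0 \<le> a" and "a < b" and "b \<le> 1"
    and "\<forall>s\<in>{a..b}. f s > 0"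
    and "\<forall>s\<in>{a..b}. (f has_real_derivative f' s) (at s within {a..b})"
    and "continuous_on {a..b} f'"
    and "\<exists>M. \<forall>s\<in>{a..b}. \<bar>f' s / f s\<bar> \<le> M"
    and "(LBINT s:{a..b}. f s) = 1"
    and "(LBINT s:{a..b}. s * f s) = 1 / 2"
  shows "\<forall>i<n. \<exists>x P T.
           optimal_for a b f n i x \<and> monotone_threshold a b n x i P \<and>
           T \<subseteq> P \<and> countable T \<and>
           (\<forall>S\<in>P - T. \<forall>u\<in>S. \<forall>y\<in>others_box a b n i.
              x (y(i := u)) i = (if LRset (y(i := u)) {..<n} \<ge> 1 then 1 else 0)) \<and>
           (\<forall>S\<in>T. \<forall>S'\<in>T. adjacent S S' \<longrightarrow>
              deterministic_threshold_on a b n x i S \<or> deterministic_threshold_on a b n x i S')"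
proof (intro allI impI)
  fix i assume "i < n"
  interpret signals n i a b f f'
    by unfold_locales (use assms \<open>i < n\<close> in auto)
  show "\<exists>x P T.
           optimal_for a b f n i x \<and> monotone_threshold a b n x i P \<and>
           T \<subseteq> P \<and> countable T \<and>
           (\<forall>S\<in>P - T. \<forall>u\<in>S. \<forall>y\<in>others_box a b n i.
              x (y(i := u)) i = (if LRset (y(i := u)) {..<n} \<ge> 1 then 1 else 0)) \<and>
           (\<forall>S\<in>T. \<forall>S'\<in>T. adjacent S S' \<longrightarrow>
              deterministic_threshold_on a b n x i S \<or> deterministic_threshold_on a b n x i S')"
    by (rule optimal_mechanism)
qed

end
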